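(* Assume that there exists $\alpha^*\in[0,1)$ such that for all $\alpha\in(\alpha^*,1]$: (i) the function $x\mapsto\mathbb{E}[h_\alpha(x-D)]$ is quasiconvex on $\mathbb{X}$; and (ii) $\lim_{x\to-\infty}\mathbb{E}[h_\alpha(x-D)]>K+\inf_{x\in\mathbb{X}}\mathbb{E}[h_\alpha(x-D)]$. Then the inventory model satisfies: (i) $w^*:=\inf_{x\in\mathbb{X}}w^{\rm ac}(x)<+\infty$; and (ii) $\sup_{\alpha\in[0,1)}u_\alpha(x)<+\infty$ for every $x\in\mathbb{X}$.
   Context: Inventory model. Either (a) $\mathbb{X}=\mathbb{R}$ (states) and $\mathbb{A}=[0,+\infty)$ (actions), or (b) $\mathbb{X}=\mathbb{Z}$, $\mathbb{A}=\{0,1,2,\ldots\}$ and the demand is integer valued. Constants $K>0$ (fixed ordering cost), $\bar c>0$ (unit ordering cost). $D_1,D_2,\ldots$ are i.i.d. nonnegative finite random variables, $D$ has the same distribution as $D_1$, $\mathbb{E}[D]<+\infty$, $P(D>0)>0$. The holding/backlog cost function $h$ is such that $x\mapsto\mathbb{E}[h(x-D)]$ is finite, continuous and nonnegative on $\mathbb{X}$ and $\mathbb{E}[h(x-D)]\to+\infty$ as $|x|\to+\infty$. Dynamics: $x_{t+1}=x_t+a_t-D_{t+1}$, $t=0,1,\ldots$. One-step cost: $c(x,a)=K\mathbf{1}_{\{a>0\}}+\bar c a+\mathbb{E}[h(x+a-D)]$. Policies may be randomized and history-dependent; $\mathbb{E}_x^\pi$ is the expectation for initial state $x$ and policy $\pi$.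 $v_\alpha^\pi(x)=\mathbb{E}_x^\pi[\sum_{t=0}^\infty\alpha^t c(x_t,a_t)]$ and $v_\alpha(x)=\inf_\pi v^\pi_\alpha(x)$ for $\alpha\in[0,1)$; $m_\alpha:=\inf_{x\in\mathbb{X}}v_\alpha(x)$ and $u_\alpha(x):=v_\alpha(x)-m_\alpha$. Average cost: $w^\pi(x)=\limsup_{N\to+\infty}\frac1N\mathbb{E}_x^\pi[\sum_{t=0}^{N-1}c(x_t,a_t)]$, $w^{\rm ac}(x)=\inf_\pi w^\pi(x)$. For $\alpha\in(0,1]$: $h_\alpha(x):=h(x)+(1-\alpha)\bar c x+\bar c\,\mathbb{E}[D]$. A function $f$ is quasiconvex if $f(\lambda x+(1-\lambda)y)\le\max\{f(x),f(y)\}$ for all $x,y$ and $\lambda\in[0,1]$ (if $\mathbb{X}=\mathbb{Z}$, whenever $x,y,\lambda x+(1-\lambda)y\in\mathbb{Z}$). *)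

theory Defs
  imports "HOL-Probability.Probability"
begin

text \<open>Quasiconvexity on a set that need not be convex, such as the integers: the inequality is
  required at those convex combinations that lie in the set.\<close>

definition quasiconvex_on :: "real set \<Rightarrow> (real \<Rightarrow> real) \<Rightarrow> bool" where
  "quasiconvex_on S f \<longleftrightarrow>
     (\<forall>x\<in>S. \<forall>y\<in>S. \<forall>l\<in>{0..1}. l * x + (1 - l) * y \<in> S \<longrightarrow>
        f (l * x + (1 - l) * y) \<le> max (f x) (f y))"

text \<open>States and actions are real numbers in both variants of the model; the integer variant has
  \<open>X = \<int>\<close> and \<open>A = \<nat>\<close> as subsets of the reals. The demands are \<open>D 1, D 2, \<dots>\<close> (the value \<open>D 0\<close> is
  irrelevant), and \<open>D 1\<close> serves as the generic demand. Finiteness of an expectation is integrability.\<close>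

locale inventory_model = prob_space M
  for M :: "'w measure" +
  fixes D :: "nat \<Rightarrow> 'w \<Rightarrow> real"
    and X A :: "real set"
    and K cbar :: real
    and h :: "real \<Rightarrow> real"
  assumes K_pos: "0 < K"
    and cbar_pos: "0 < cbar"
    and spaces: "(X = UNIV \<and> A = {0..}) \<or>
      (X = \<int> \<and> A = \<nat> \<and> (\<forall>t\<ge>1. \<forall>\<omega>\<in>space M. D t \<omega> \<in> \<int>))"
    and D_indep: "indep_vars (\<lambda>_. borel) D {1..}"
    and D_ident: "t \<ge> 1 \<Longrightarrow> distr M borel (D t) = distr M borel (D 1)"
    and D_nonneg: "t \<ge> 1 \<Longrightarrow> \<omega> \<in> space M \<Longrightarrow> 0 \<le> D t \<omega>"
    and D_integrable: "integrable M (D 1)"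
    and D_nontrivial: "0 < prob {\<omega> \<in> space M. 0 < D 1 \<omega>}"
    and h_integrable: "x \<in> X \<Longrightarrow> integrable M (\<lambda>\<omega>. h (x - D 1 \<omega>))"
    and Eh_continuous: "continuous_on X (\<lambda>x. expectation (\<lambda>\<omega>. h (x - D 1 \<omega>)))"
    and Eh_nonneg: "x \<in> X \<Longrightarrow> 0 \<le> expectation (\<lambda>\<omega>. h (x - D 1 \<omega>))"
    and Eh_at_infinity: "filterlim (\<lambda>x. expectation (\<lambda>\<omega>. h (x - D 1 \<omega>))) at_top
      (at_infinity \<sqinter> principal X)"
begin

definition cost :: "real \<Rightarrow> real \<Rightarrow> real" where
  "cost x a = K * (if a > 0 then 1 else 0) + cbar * a + expectation (\<lambda>\<omega>. h (x + a - D 1 \<omega>))"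

definition h_disc :: "real \<Rightarrow> real \<Rightarrow> real" where
  "h_disc \<alpha> x = h x + (1 - \<alpha>) * cbar * x + cbar * expectation (D 1)"

definition Eh_disc :: "real \<Rightarrow> real \<Rightarrow> real" where
  "Eh_disc \<alpha> x = expectation (\<lambda>\<omega>. h_disc \<alpha> (x - D 1 \<omega>))"

definition SX :: "real measure" where
  "SX = restrict_space borel X"

definition SA :: "real measure" where
  "SA = restrict_space borel A"

text \<open>A randomized history-dependent policy is a sequence of stochastic kernels. The history
  \<open>(x\<^sub>0, a\<^sub>0, \<dots>, x\<^sub>t\<^sub>-\<^sub>1, a\<^sub>t\<^sub>-\<^sub>1, x\<^sub>t)\<close> is encoded as the pair of
  \<open>\<lambda>i\<in>{0..<t}. (x\<^sub>i, a\<^sub>i)\<close> and \<open>x\<^sub>t\<close>.\<close>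

definition policies :: "(nat \<Rightarrow> (nat \<Rightarrow> real \<times> real) \<times> real \<Rightarrow> real measure) set" where
  "policies = {\<pi>. \<forall>t. \<pi> t \<in>
     (PiM {0..<t} (\<lambda>_. SX \<Otimes>\<^sub>M SA) \<Otimes>\<^sub>M SX) \<rightarrow>\<^sub>M prob_algebra SA}"

text \<open>Conditional law of \<open>x\<^sub>t\<close> given the state-action pairs before time \<open>t\<close>, for the dynamics
  \<open>x\<^sub>t\<^sub>+\<^sub>1 = x\<^sub>t + a\<^sub>t - D\<^sub>t\<^sub>+\<^sub>1\<close>; by independence, the past does not affect the law of \<open>D\<^sub>t\<^sub>+\<^sub>1\<close>.\<close>

fun state_law :: "real \<Rightarrow> nat \<Rightarrow> (nat \<Rightarrow> real \<times> real) \<Rightarrow> real measure" where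
  "state_law x 0 \<omega> = return SX x"
| "state_law x (Suc t) \<omega> = distr M SX (\<lambda>w. fst (\<omega> t) + snd (\<omega> t) - D (Suc t) w)"

definition step_law ::
    "(nat \<Rightarrow> (nat \<Rightarrow> real \<times> real) \<times> real \<Rightarrow> real measure) \<Rightarrow> real \<Rightarrow>
     nat \<Rightarrow> (nat \<Rightarrow> real \<times> real) \<Rightarrow> (real \<times> real) measure" where
  "step_law \<pi> x t \<omega> =
     state_law x t \<omega> \<bind> (\<lambda>y. distr (\<pi> t (\<omega>, y)) (SX \<Otimes>\<^sub>M SA) (\<lambda>a. (y, a)))"

text \<open>The law of the trajectory \<open>(x\<^sub>t, a\<^sub>t)\<^sub>t\<close> under policy \<open>\<pi>\<close> from initial state \<open>x\<close>, obtained from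
  the Ionescu-Tulcea theorem; the term is what \<open>PF.lim\<close> denotes inside the locale
  \<open>Ionescu_Tulcea\<close>. Lemma \<open>Ionescu_Tulcea_step_law\<close> below shows that the locale applies.\<close>

definition traj ::
    "(nat \<Rightarrow> (nat \<Rightarrow> real \<times> real) \<times> real \<Rightarrow> real measure) \<Rightarrow> real \<Rightarrow>
     (nat \<Rightarrow> real \<times> real) measure" where
  "traj \<pi> x = projective_family.lim UNIV
     (Ionescu_Tulcea.CI (step_law \<pi> x) (\<lambda>_. SX \<Otimes>\<^sub>M SA)) (\<lambda>_. SX \<Otimes>\<^sub>M SA)"

text \<open>Costs are nonnegative, so values are taken in \<open>[0, \<infinity>]\<close>.\<close>

definition disc_value_pol ::
    "real \<Rightarrow> (nat \<Rightarrow> (nat \<Rightarrow> real \<times> real) \<times> real \<Rightarrow> real measure) \<Rightarrow> real \<Rightarrow> ennreal" where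
  "disc_value_pol \<alpha> \<pi> x =
     (\<integral>\<^sup>+ \<omega>. (\<Sum>t. ennreal (\<alpha> ^ t * cost (fst (\<omega> t)) (snd (\<omega> t)))) \<partial>traj \<pi> x)"

definition disc_value :: "real \<Rightarrow> real \<Rightarrow> ennreal" where
  "disc_value \<alpha> x = (INF \<pi>\<in>policies. disc_value_pol \<alpha> \<pi> x)"

definition min_disc_value :: "real \<Rightarrow> ennreal" where
  "min_disc_value \<alpha> = (INF x\<in>X. disc_value \<alpha> x)"

text \<open>On \<open>X\<close> the subtraction never truncates; since \<open>\<infinity> - y = \<infinity>\<close> in \<open>ennreal\<close>, the difference is finite
  only if \<open>disc_value \<alpha> x\<close> is.\<close>

definition rel_value :: "real \<Rightarrow> real \<Rightarrow> ennreal" where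
  "rel_value \<alpha> x = disc_value \<alpha> x - min_disc_value \<alpha>"

definition avg_value_pol ::
    "(nat \<Rightarrow> (nat \<Rightarrow> real \<times> real) \<times> real \<Rightarrow> real measure) \<Rightarrow> real \<Rightarrow> ennreal" where
  "avg_value_pol \<pi> x = limsup (\<lambda>N. ennreal (1 / real N) *
     (\<integral>\<^sup>+ \<omega>. (\<Sum>t<N. ennreal (cost (fst (\<omega> t)) (snd (\<omega> t)))) \<partial>traj \<pi> x))"

definition avg_value :: "real \<Rightarrow> ennreal" where
  "avg_value x = (INF \<pi>\<in>policies. avg_value_pol \<pi> x)"

lemma space_SX [simp]: "space SX = X"
  and space_SA [simp]: "space SA = A"
  by (simp_all add: SX_def SA_def space_restrict_space)

lemma D_measurable: "t \<ge> 1 \<Longrightarrow> D t \<in> borel_measurable M"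
  using D_indep by (auto simp: indep_vars_def)

lemma next_state_in_X:
  assumes "x \<in> X" "a \<in> A" "w \<in> space M"
  shows "x + a - D (Suc t) w \<in> X"
  using spaces assms Nats_subset_Ints by auto

lemma fst_plus_snd_measurable:
  "(\<lambda>p. fst p + snd p) \<in> borel_measurable (SX \<Otimes>\<^sub>M SA)"
proof -
  have "(\<lambda>x. x) \<in> borel_measurable SX" "(\<lambda>x. x) \<in> borel_measurable SA"
    by (auto simp: SX_def SA_def intro!: measurable_restrict_space1)
  then show ?thesis by measurable
qed

lemma state_law_measurable:
  assumes "x \<in> X"
  shows "state_law x t \<in> PiM {0..<t} (\<lambda>_. SX \<Otimes>\<^sub>M SA) \<rightarrow>\<^sub>M prob_algebra SX"
proof (cases t)
  case 0
  have "return SX x \<in> space (prob_algebra SX)"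
    using assms by (simp add: space_prob_algebra prob_space_return)
  then show ?thesis by (simp add: 0 state_law.simps(1)[abs_def])
next
  case (Suc s)
  let ?H = "PiM {0..<Suc s} (\<lambda>_. SX \<Otimes>\<^sub>M SA)"
  have c: "(\<lambda>\<omega>. \<omega> s) \<in> ?H \<rightarrow>\<^sub>M SX \<Otimes>\<^sub>M SA"
    by (rule measurable_component_singleton) simp
  have [measurable]: "(\<lambda>\<omega>. fst (\<omega> s) + snd (\<omega> s)) \<in> borel_measurable ?H"
    using measurable_compose[OF c fst_plus_snd_measurable] .
  have [measurable]: "D (Suc s) \<in> borel_measurable M"
    by (rule D_measurable) simp
  have "(\<lambda>(\<omega>, w). fst (\<omega> s) + snd (\<omega> s) - D (Suc s) w) \<in> borel_measurable (?H \<Otimes>\<^sub>M M)"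
    by measurable
  moreover have "(\<lambda>(\<omega>, w). fst (\<omega> s) + snd (\<omega> s) - D (Suc s) w) \<in> space (?H \<Otimes>\<^sub>M M) \<rightarrow> X"
  proof
    fix p
    assume "p \<in> space (?H \<Otimes>\<^sub>M M)"
    then have "fst p s \<in> X \<times> A" "snd p \<in> space M"
      by (auto simp: space_pair_measure space_PiM PiE_iff)
    then show "(case p of (\<omega>, w) \<Rightarrow> fst (\<omega> s) + snd (\<omega> s) - D (Suc s) w) \<in> X"
      unfolding case_prod_beta' by (intro next_state_in_X) auto
  qed
  ultimately have "(\<lambda>(\<omega>, w). fst (\<omega> s) + snd (\<omega> s) - D (Suc s) w) \<in> ?H \<Otimes>\<^sub>M M \<rightarrow>\<^sub>M restrict_space borel X"
    by (intro measurable_restrict_space2)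
  then have "(\<lambda>(\<omega>, w). fst (\<omega> s) + snd (\<omega> s) - D (Suc s) w) \<in> ?H \<Otimes>\<^sub>M M \<rightarrow>\<^sub>M SX"
    by (simp only: SX_def[symmetric])
  moreover have "M \<in> space (prob_algebra M)"
    by (simp add: space_prob_algebra prob_space_axioms)
  ultimately show ?thesis
    unfolding Suc state_law.simps(2)[abs_def]
    by (intro measurable_distr_prob_space2[where M = M]) simp_all
qed

lemma step_law_measurable:
  assumes "x \<in> X" "\<pi> \<in> policies"
  shows "step_law \<pi> x t \<in> PiM {0..<t} (\<lambda>_. SX \<Otimes>\<^sub>M SA) \<rightarrow>\<^sub>M prob_algebra (SX \<Otimes>\<^sub>M SA)"
proof -
  have "\<pi> t \<in> (PiM {0..<t} (\<lambda>_. SX \<Otimes>\<^sub>M SA) \<Otimes>\<^sub>M SX) \<rightarrow>\<^sub>M prob_algebra SA"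
    using assms by (auto simp: policies_def)
  then have "(\<lambda>p. distr (\<pi> t p) (SX \<Otimes>\<^sub>M SA) (\<lambda>a. (snd p, a))) \<in>
      (PiM {0..<t} (\<lambda>_. SX \<Otimes>\<^sub>M SA) \<Otimes>\<^sub>M SX) \<rightarrow>\<^sub>M prob_algebra (SX \<Otimes>\<^sub>M SA)"
    by (rule measurable_distr_prob_space2) measurable
  then show ?thesis
    unfolding step_law_def[abs_def]
    by (intro measurable_bind_prob_space2[OF state_law_measurable[OF assms(1)]])
      (simp add: case_prod_beta')
qed

lemma Ionescu_Tulcea_step_law:
  assumes "x \<in> X" "\<pi> \<in> policies"
  shows "Ionescu_Tulcea (step_law \<pi> x) (\<lambda>_. SX \<Otimes>\<^sub>M SA)"
  unfolding Ionescu_Tulcea_def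
proof (intro conjI allI impI)
  show "step_law \<pi> x t \<in> PiM {0..<t} (\<lambda>_. SX \<Otimes>\<^sub>M SA) \<rightarrow>\<^sub>M subprob_algebra (SX \<Otimes>\<^sub>M SA)" for t
    by (intro measurable_prob_algebraD step_law_measurable assms)
  show "prob_space (step_law \<pi> x t \<omega>)"
    if "\<omega> \<in> space (PiM {0..<t} (\<lambda>_. SX \<Otimes>\<^sub>M SA))" for t \<omega>
    using measurable_space[OF step_law_measurable[OF assms] that]
    by (simp add: space_prob_algebra)
qed

end

end

theory Submission
  imports Defs
begin

text \<open>Fix a level \<open>b\<close> far to the left, where the transformed holding cost is decreasing. For discount
  factors close to \<open>1\<close>, value iteration started from an upper bound for the cost of the policy that
  orders up to \<open>b\<close> converges to the value function \<open>v\<close>, and each iterate inherits two properties.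
  Below \<open>b\<close>, starting lower is never cheaper, because the lower state can be imitated from above.
  Far to the right, where the holding cost exceeds that of ordering back up to \<open>b\<close> in every period,
  starting at \<open>b\<close> is more expensive by at most a constant. Hence \<open>b\<close> minimizes \<open>v\<close> up to a constant.
  Conversely, from any \<open>x\<close> one can wait until the inventory drops below \<open>b\<close> and then order up to
  \<open>b\<close>, at an expected cost that is bounded independently of the discount factor. For smaller
  discount factors, and for the average cost, the policy that orders up to \<open>b\<close> gives the bounds.\<close>

text \<open>For the function \<open>v x + cbar * x\<close> the unit cost of an order disappears and
  the holding cost becomes \<open>Eh_disc \<alpha>\<close>. This is why the first inherited property
  carries the term \<open>cbar * (x' - x)\<close>, which is dropped only at the end. The level
  \<open>b\<close> must not depend on the discount factor. It is chosen for a single factor \<beta>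
  < 1: \<open>Eh_disc \<alpha>\<close> and \<open>EH\<close> differ by an affine function of slope
  \<open>(1 - \<alpha>) * cbar\<close>, so decrease below \<open>b\<close> for \<beta> gives
  decrease for all \<alpha> between \<beta> and 1. Quasiconvexity at \<alpha> = 1 enters separately:
  there \<open>Eh_disc\<close> is \<open>EH\<close> plus a constant, so holding costs on a segment
  are bounded by those at its endpoints, uniformly in \<alpha>. The technical obstacle is
  measurability: the infimum over order-up-to levels may run over an uncountable set, and
  near-optimal orders must depend measurably on the state. A reduction to countably many levels
  settles both.\<close>

section \<open>Finite-dimensional marginals of the Ionescu-Tulcea measure\<close>

lemma (in Ionescu_Tulcea) nn_integral_lim_restrict:
  assumes f [measurable]: "f \<in> borel_measurable (PiM {0..<n} M)"
  shows "(\<integral>\<^sup>+\<omega>. f (restrict \<omega> {0..<n}) \<partial>PF.lim) = (\<integral>\<^sup>+\<omega>. f \<omega> \<partial>C 0 n (\<lambda>x. undefined))"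
proof -
  \<comment> \<open>The marginal \<open>CI J\<close> is defined by running the kernels up to the
    least time bounding \<open>J\<close> and restricting to \<open>J\<close>; for an initial segment
    this restriction is the identity.\<close>
  have u: "up_to {0..<n} = n"
  proof (rule antisym)
    show "up_to {0..<n} \<le> n" by (simp add: up_to_iff_Ico)
    show "n \<le> up_to {0..<n}"
      using up_to_less[of "{0..<n}" "up_to {0..<n}"] by (force simp: not_le)
  qed
  have s: "sets (C 0 n (\<lambda>x. undefined)) = sets (PiM {0..<n} M)"
    using sets_C[of "\<lambda>x. undefined" 0 n] by (simp add: space_PiM)
  have r: "(\<lambda>\<omega>. restrict \<omega> {0..<n}) \<in> measurable PF.lim (PiM {0..<n} M)"
    by (simp add: measurable_cong_sets[OF PF.sets_lim refl] measurable_restrict_subset)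
  have "(\<integral>\<^sup>+\<omega>. f (restrict \<omega> {0..<n}) \<partial>PF.lim) = (\<integral>\<^sup>+\<omega>. f \<omega> \<partial>CI {0..<n})"
    by (simp add: distr_lim[symmetric] nn_integral_distr[OF r])
  also have "\<dots> = (\<integral>\<^sup>+\<omega>. f (restrict \<omega> {0..<n}) \<partial>C 0 n (\<lambda>x. undefined))"
    unfolding CI_def u
    by (subst nn_integral_distr)
      (auto simp: measurable_cong_sets[OF s refl] intro!: measurable_restrict_subset)
  also have "\<dots> = (\<integral>\<^sup>+\<omega>. f \<omega> \<partial>C 0 n (\<lambda>x. undefined))"
    using sets_eq_imp_space_eq[OF s]
    by (intro nn_integral_cong) (simp add: space_PiM PiE_def extensional_restrict)
  finally show ?thesis .
qed

text \<open>The law of the first \<open>n + 1\<close> coordinates is the law of the first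
  \<open>n\<close> extended by the kernel \<open>P n\<close>. The history is restricted because
  \<open>P n\<close> is a kernel on the product over \<open>{0..<n}\<close>, while the limit measure
  lives on all coordinates.\<close>

lemma (in Ionescu_Tulcea) nn_integral_lim_component:
  assumes f [measurable]: "f \<in> borel_measurable (M n)"
  shows "(\<integral>\<^sup>+\<omega>. f (\<omega> n) \<partial>PF.lim) =
    (\<integral>\<^sup>+\<omega>. (\<integral>\<^sup>+z. f z \<partial>P n (restrict \<omega> {0..<n})) \<partial>PF.lim)"
proof -
  let ?C = "\<lambda>n. C 0 n (\<lambda>x. undefined)"
  have s: "sets (?C n) = sets (PiM {0..<n} M)"
    using sets_C[of "\<lambda>x. undefined" 0 n] by (simp add: space_PiM)
  have ne: "space (?C n) \<noteq> {}"
    using prob_space_C[of "\<lambda>x. undefined" 0 n]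
    by (simp add: space_PiM prob_space.not_empty)
  have [measurable]: "(\<lambda>\<omega>. f (\<omega> n)) \<in> borel_measurable (PiM {0..<Suc n} M)"
    by (rule measurable_compose[where f="\<lambda>\<omega>. \<omega> n", OF _ f])
      (rule measurable_component_singleton, simp)
  have "(\<integral>\<^sup>+\<omega>. f (\<omega> n) \<partial>PF.lim) = (\<integral>\<^sup>+\<omega>. f ((restrict \<omega> {0..<Suc n}) n) \<partial>PF.lim)"
    by simp
  also have "\<dots> = (\<integral>\<^sup>+\<omega>. f (\<omega> n) \<partial>?C (Suc n))"
    by (rule nn_integral_lim_restrict) measurable
  also have "\<dots> = (\<integral>\<^sup>+\<omega>. (\<integral>\<^sup>+\<omega>'. f (\<omega>' n) \<partial>eP n \<omega>) \<partial>?C n)"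
    using ne by (simp, subst nn_integral_bind[where B="PiM {0..<Suc n} M"])
      (auto simp: measurable_cong_sets[OF s refl])
  also have "\<dots> = (\<integral>\<^sup>+\<omega>. (\<integral>\<^sup>+z. f z \<partial>P n \<omega>) \<partial>?C n)"
    using sets_eq_imp_space_eq[OF s] by (intro nn_integral_cong) (simp add: nn_integral_eP)
  also have "\<dots> = (\<integral>\<^sup>+\<omega>. (\<integral>\<^sup>+z. f z \<partial>P n (restrict \<omega> {0..<n})) \<partial>PF.lim)"
    by (rule nn_integral_lim_restrict[symmetric])
      (rule measurable_compose[OF P nn_integral_measurable_subprob_algebra[OF f]])
  finally show ?thesis .
qed

section \<open>Quasiconvex functions on the line, and countable reduction of infima over ordering
  levels\<close>

lemma quasiconvex_on_between:
  assumes f: "quasiconvex_on S f" and S: "x \<in> S" "y \<in> S" "z \<in> S" and z: "x \<le> z" "z \<le> y"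
  shows "f z \<le> max (f x) (f y)"
proof (cases "x = y")
  case False
  then have xy: "x < y" using z by simp
  define l where "l = (y - z) / (y - x)"
  have l: "l \<in> {0..1}" using z xy by (simp add: l_def)
  have "l * (y - x) = y - z" using xy by (simp add: l_def)
  then have eq: "l * x + (1 - l) * y = z" by (simp add: algebra_simps)
  then have "l * x + (1 - l) * y \<in> S" using S by simp
  then have "f (l * x + (1 - l) * y) \<le> max (f x) (f y)"
    using f S l unfolding quasiconvex_on_def by blast
  then show ?thesis by (simp only: eq)
qed (use z in auto)

text \<open>Suppose \<open>f x < f y\<close>. As \<open>y\<close> lies between \<open>x\<close> and
  \<open>c\<close>, \<open>f y\<close> is at most \<open>f c\<close>; as \<open>b\<close> lies
  between \<open>y\<close> and \<open>c\<close>, so is \<open>f b\<close>, contradicting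
  \<open>f c < f b\<close>.\<close>

lemma quasiconvex_on_antimono:
  assumes f: "quasiconvex_on S f" and S: "b \<in> S" "c \<in> S" "x \<in> S" "y \<in> S"
    and "b < c" "f c < f b" and xy: "x \<le> y" "y \<le> b"
  shows "f y \<le> f x"
proof (rule ccontr)
  assume "\<not> f y \<le> f x"
  moreover have "f y \<le> max (f x) (f c)"
    using assms by (intro quasiconvex_on_between[OF f]) auto
  moreover have "f b \<le> max (f y) (f c)"
    using assms by (intro quasiconvex_on_between[OF f]) auto
  ultimately show False using assms by auto
qed

text \<open>The objective depends on \<open>x\<close> only through an additive affine term. Hence a
  minimizing sequence for a rational threshold \<open>r\<close> is also minimizing over levels above
  \<open>r\<close> for every \<open>x < r\<close>, and each \<open>y > x\<close> lies above some
  such \<open>r\<close>. One countable set therefore works for all \<open>x\<close> at once, without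
  any regularity of \<open>G\<close>.\<close>

lemma countable_subset_INF_ordering:
  fixes G :: "real \<Rightarrow> ennreal" and S :: "real set"
  assumes "0 \<le> K" "0 \<le> c"
  obtains Y where "countable Y" "Y \<subseteq> S"
    "\<And>x. (INF y\<in>{y\<in>Y. x < y}. ennreal (K + c * (y - x)) + G y) =
      (INF y\<in>{y\<in>S. x < y}. ennreal (K + c * (y - x)) + G y)"
proof -
  let ?F = "\<lambda>x y. ennreal (K + c * (y - x)) + G y"
  have "\<exists>z :: nat \<Rightarrow> real. range z \<subseteq> {y\<in>S. r < y} \<and>
      (INF i. ?F r (z i)) = (INF y\<in>{y\<in>S. r < y}. ?F r y)"
    if ne: "{y\<in>S. r < y} \<noteq> {}" for r
  proof -
    have "?F r ` {y\<in>S. r < y} \<noteq> {}" using ne by blast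
    from ennreal_Inf_countable_INF[OF this] obtain e :: "nat \<Rightarrow> ennreal"
      where e: "range e \<subseteq> ?F r ` {y\<in>S. r < y}" "(INF y\<in>{y\<in>S. r < y}. ?F r y) = (INF i. e i)"
      by blast
    then have "\<exists>y. y \<in> {y\<in>S. r < y} \<and> e i = ?F r y" for i by blast
    then obtain z where z: "\<And>i. z i \<in> {y\<in>S. r < y}" "\<And>i. e i = ?F r (z i)" by metis
    then show ?thesis using e(2) by (intro exI[of _ z]) auto
  qed
  then have "\<forall>r. \<exists>z :: nat \<Rightarrow> real. {y\<in>S. r < y} \<noteq> {} \<longrightarrow> range z \<subseteq> {y\<in>S. r < y} \<and>
      (INF i. ?F r (z i)) = (INF y\<in>{y\<in>S. r < y}. ?F r y)"
    by blast
  from choice[OF this] obtain z :: "real \<Rightarrow> nat \<Rightarrow> real" where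
    z: "\<And>r. {y\<in>S. r < y} \<noteq> {} \<Longrightarrow> range (z r) \<subseteq> {y\<in>S. r < y}"
      "\<And>r. {y\<in>S. r < y} \<noteq> {} \<Longrightarrow> (INF i. ?F r (z r i)) = (INF y\<in>{y\<in>S. r < y}. ?F r y)"
    by blast
  define Y where "Y = (\<Union>r\<in>{r\<in>\<rat>. {y\<in>S. r < y} \<noteq> {}}. range (z r))"
  show ?thesis
  proof
    have "countable {r\<in>\<rat>. {y\<in>S. r < y} \<noteq> {}}"
      by (rule countable_subset[OF _ countable_rat]) auto
    then show "countable Y" unfolding Y_def by blast
    show YS: "Y \<subseteq> S" unfolding Y_def using z(1) by blast
    fix x
    show "(INF y\<in>{y\<in>Y. x < y}. ?F x y) = (INF y\<in>{y\<in>S. x < y}. ?F x y)"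
    proof (rule antisym)
      show "(INF y\<in>{y\<in>S. x < y}. ?F x y) \<le> (INF y\<in>{y\<in>Y. x < y}. ?F x y)"
        using YS by (intro INF_superset_mono) auto
      show "(INF y\<in>{y\<in>Y. x < y}. ?F x y) \<le> (INF y\<in>{y\<in>S. x < y}. ?F x y)"
      proof (rule INF_greatest)
        fix y assume y: "y \<in> {y\<in>S. x < y}"
        obtain r where r: "r \<in> \<rat>" "x < r" "r < y" using Rats_dense_in_real[of x y] y by auto
        have ne: "{y\<in>S. r < y} \<noteq> {}" using y r by auto
        have split: "?F x u = ennreal (c * (r - x)) + ?F r u" if "r < u" for u
        proof -
          have "K + c * (u - x) = c * (r - x) + (K + c * (u - r))" by (simp add: algebra_simps)
          moreover have "0 \<le> c * (r - x)" "0 \<le> K + c * (u - r)" using assms r that by simp_all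
          ultimately have "ennreal (K + c * (u - x)) = ennreal (c * (r - x)) + ennreal (K + c * (u - r))"
            by (simp only: ennreal_plus)
          then show ?thesis by (simp add: add.assoc)
        qed
        have zr: "r < z r i" "z r i \<in> Y" for i
          using z(1)[OF ne] ne r(1) unfolding Y_def by auto
        have "(INF y\<in>{y\<in>Y. x < y}. ?F x y) \<le> (INF i. ?F x (z r i))"
          using zr r(2) by (intro INF_greatest INF_lower) (auto intro: less_trans)
        also have "\<dots> = (INF i. ennreal (c * (r - x)) + ?F r (z r i))"
          using zr by (simp only: split)
        also have "\<dots> = ennreal (c * (r - x)) + (INF y\<in>{y\<in>S. r < y}. ?F r y)"
          by (simp only: INF_ennreal_const_add z(2)[OF ne])
        also have "\<dots> \<le> ennreal (c * (r - x)) + ?F r y"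
          using y r by (intro add_left_mono INF_lower) auto
        also have "\<dots> = ?F x y" using r by (simp only: split)
        finally show "(INF y\<in>{y\<in>Y. x < y}. ?F x y) \<le> ?F x y" .
      qed
    qed
  qed
qed

context inventory_model
begin

subsection \<open>Trajectories\<close>

lemma state_law_cong:
  "(\<And>i. i < t \<Longrightarrow> \<omega> i = \<omega>' i) \<Longrightarrow> state_law x t \<omega> = state_law x t \<omega>'"
  by (cases t) auto

lemma sets_traj:
  assumes "x \<in> X" "\<pi> \<in> policies"
  shows "sets (traj \<pi> x) = sets (PiM UNIV (\<lambda>_. SX \<Otimes>\<^sub>M SA))"
proof -
  interpret IT: Ionescu_Tulcea "step_law \<pi> x" "\<lambda>_. SX \<Otimes>\<^sub>M SA"
    by (rule Ionescu_Tulcea_step_law) fact+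
  show ?thesis unfolding traj_def by (rule IT.PF.sets_lim)
qed

lemma prob_space_traj:
  assumes "x \<in> X" "\<pi> \<in> policies"
  shows "prob_space (traj \<pi> x)"
proof -
  interpret IT: Ionescu_Tulcea "step_law \<pi> x" "\<lambda>_. SX \<Otimes>\<^sub>M SA"
    by (rule Ionescu_Tulcea_step_law) fact+
  \<comment> \<open>Total mass is preserved by the projection to the empty set of coordinates, whose
    marginal is known to be a probability measure.\<close>
  have "prob_space (distr IT.PF.lim (PiM {} (\<lambda>_. SX \<Otimes>\<^sub>M SA)) (\<lambda>\<omega>. restrict \<omega> {}))"
    by (subst IT.distr_lim) (auto intro: IT.PF.prob_space_P)
  then show ?thesis
    unfolding traj_def
    by (rule prob_space_distrD[rotated])
      (simp add: measurable_cong_sets[OF IT.PF.sets_lim refl] measurable_restrict_subset)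
qed

lemma traj_space:
  assumes "x \<in> X" "\<pi> \<in> policies" "\<omega> \<in> space (traj \<pi> x)"
  shows "fst (\<omega> t) \<in> X" "snd (\<omega> t) \<in> A"
proof -
  have "\<omega> \<in> space (PiM UNIV (\<lambda>_. SX \<Otimes>\<^sub>M SA))"
    using assms sets_eq_imp_space_eq[OF sets_traj] by blast
  then have "\<omega> t \<in> X \<times> A" by (auto simp: space_PiM PiE_iff space_pair_measure)
  then show "fst (\<omega> t) \<in> X" "snd (\<omega> t) \<in> A" by auto
qed

lemma traj_component_measurable:
  assumes "x \<in> X" "\<pi> \<in> policies"
  shows "(\<lambda>\<omega>. \<omega> t) \<in> traj \<pi> x \<rightarrow>\<^sub>M SX \<Otimes>\<^sub>M SA"
  unfolding measurable_cong_sets[OF sets_traj[OF assms] refl]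
  by (rule measurable_component_singleton) simp

lemma state_law_in:
  assumes "x \<in> X" "\<omega> \<in> space (traj \<pi> x)" "\<pi> \<in> policies"
  shows "state_law x t (restrict \<omega> {0..<t}) \<in> space (prob_algebra SX)"
proof -
  have "restrict \<omega> {0..<t} \<in> space (PiM {0..<t} (\<lambda>_. SX \<Otimes>\<^sub>M SA))"
    using traj_space[OF assms(1,3,2)]
    by (auto simp: space_PiM space_pair_measure mem_Times_iff)
  then show ?thesis using measurable_space[OF state_law_measurable[OF assms(1)]] by blast
qed

text \<open>Disintegration into past, current state and action. The law of the state depends on the
  past through the preceding pair only, so there \<omega> need not be restricted, whereas the policy
  receives the encoded history.\<close>

lemma nn_integral_traj:
  assumes x: "x \<in> X" and \<pi>: "\<pi> \<in> policies"
    and f [measurable]: "f \<in> borel_measurable (SX \<Otimes>\<^sub>M SA)"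
  shows "(\<integral>\<^sup>+\<omega>. f (\<omega> t) \<partial>traj \<pi> x) =
    (\<integral>\<^sup>+\<omega>. (\<integral>\<^sup>+y. (\<integral>\<^sup>+a. f (y, a) \<partial>\<pi> t (restrict \<omega> {0..<t}, y)) \<partial>state_law x t \<omega>) \<partial>traj \<pi> x)"
proof -
  interpret IT: Ionescu_Tulcea "step_law \<pi> x" "\<lambda>_. SX \<Otimes>\<^sub>M SA"
    by (rule Ionescu_Tulcea_step_law) fact+
  let ?H = "PiM {0..<t} (\<lambda>_. SX \<Otimes>\<^sub>M SA)"
  have \<pi>t: "\<pi> t \<in> ?H \<Otimes>\<^sub>M SX \<rightarrow>\<^sub>M prob_algebra SA"
    using \<pi> by (auto simp: policies_def)
  have "(\<integral>\<^sup>+\<omega>. f (\<omega> t) \<partial>traj \<pi> x) =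
    (\<integral>\<^sup>+\<omega>. (\<integral>\<^sup>+z. f z \<partial>step_law \<pi> x t (restrict \<omega> {0..<t})) \<partial>traj \<pi> x)"
    unfolding traj_def by (rule IT.nn_integral_lim_component) measurable
  also have "\<dots> = (\<integral>\<^sup>+\<omega>. (\<integral>\<^sup>+y. (\<integral>\<^sup>+a. f (y, a) \<partial>\<pi> t (restrict \<omega> {0..<t}, y)) \<partial>state_law x t \<omega>) \<partial>traj \<pi> x)"
  proof (rule nn_integral_cong)
    fix \<omega> assume \<omega>: "\<omega> \<in> space (traj \<pi> x)"
    let ?r = "restrict \<omega> {0..<t}"
    have r: "?r \<in> space ?H"
      using traj_space[OF x \<pi> \<omega>] by (auto simp: space_PiM space_pair_measure mem_Times_iff)
    have sl: "sets (state_law x t ?r) = sets SX" and pl: "prob_space (state_law x t ?r)"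
      using state_law_in[OF x \<omega> \<pi>] by (auto simp: space_prob_algebra)
    have k: "(\<lambda>y. \<pi> t (?r, y)) \<in> SX \<rightarrow>\<^sub>M prob_algebra SA"
      using r by (intro measurable_compose[OF _ \<pi>t]) measurable
    have k': "(\<lambda>y. distr (\<pi> t (?r, y)) (SX \<Otimes>\<^sub>M SA) (\<lambda>a. (y, a))) \<in> SX \<rightarrow>\<^sub>M prob_algebra (SX \<Otimes>\<^sub>M SA)"
      by (rule measurable_distr_prob_space2[OF k]) measurable
    have "(\<integral>\<^sup>+z. f z \<partial>step_law \<pi> x t ?r) =
      (\<integral>\<^sup>+y. (\<integral>\<^sup>+z. f z \<partial>distr (\<pi> t (?r, y)) (SX \<Otimes>\<^sub>M SA) (\<lambda>a. (y, a))) \<partial>state_law x t ?r)"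
      unfolding step_law_def
      using k' by (intro nn_integral_bind[where B="SX \<Otimes>\<^sub>M SA"])
        (auto simp: measurable_cong_sets[OF sl refl] intro!: measurable_prob_algebraD)
    also have "\<dots> = (\<integral>\<^sup>+y. (\<integral>\<^sup>+a. f (y, a) \<partial>\<pi> t (?r, y)) \<partial>state_law x t ?r)"
    proof (rule nn_integral_cong)
      fix y assume "y \<in> space (state_law x t ?r)"
      then have y: "y \<in> space SX" using sets_eq_imp_space_eq[OF sl] by simp
      then have sp: "sets (\<pi> t (?r, y)) = sets SA"
        using measurable_space[OF k y] by (simp add: space_prob_algebra)
      show "(\<integral>\<^sup>+z. f z \<partial>distr (\<pi> t (?r, y)) (SX \<Otimes>\<^sub>M SA) (\<lambda>a. (y, a))) =
        (\<integral>\<^sup>+a. f (y, a) \<partial>\<pi> t (?r, y))"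
        using y by (intro nn_integral_distr) (auto simp: measurable_cong_sets[OF sp refl])
    qed
    also have "state_law x t ?r = state_law x t \<omega>"
      by (rule state_law_cong) simp
    finally show "(\<integral>\<^sup>+z. f z \<partial>step_law \<pi> x t ?r) =
      (\<integral>\<^sup>+y. (\<integral>\<^sup>+a. f (y, a) \<partial>\<pi> t (?r, y)) \<partial>state_law x t \<omega>)" .
  qed
  finally show ?thesis .
qed

lemma nn_integral_traj_state:
  assumes x: "x \<in> X" and \<pi>: "\<pi> \<in> policies"
    and W [measurable]: "W \<in> borel_measurable SX"
  shows "(\<integral>\<^sup>+\<omega>. W (fst (\<omega> t)) \<partial>traj \<pi> x) = (\<integral>\<^sup>+\<omega>. (\<integral>\<^sup>+y. W y \<partial>state_law x t \<omega>) \<partial>traj \<pi> x)"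
proof -
  have "(\<integral>\<^sup>+\<omega>. W (fst (\<omega> t)) \<partial>traj \<pi> x) =
    (\<integral>\<^sup>+\<omega>. (\<integral>\<^sup>+y. (\<integral>\<^sup>+a. W y \<partial>\<pi> t (restrict \<omega> {0..<t}, y)) \<partial>state_law x t \<omega>) \<partial>traj \<pi> x)"
    by (subst nn_integral_traj[OF x \<pi>, of "\<lambda>p. W (fst p)"]) auto
  also have "\<dots> = (\<integral>\<^sup>+\<omega>. (\<integral>\<^sup>+y. W y \<partial>state_law x t \<omega>) \<partial>traj \<pi> x)"
  proof (intro nn_integral_cong)
    fix \<omega> y assume \<omega>: "\<omega> \<in> space (traj \<pi> x)" and y: "y \<in> space (state_law x t \<omega>)"
    have "state_law x t \<omega> = state_law x t (restrict \<omega> {0..<t})"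
      by (rule state_law_cong) simp
    then have "y \<in> X"
      using y state_law_in[OF x \<omega> \<pi>, of t] by (auto simp: space_prob_algebra dest: sets_eq_imp_space_eq)
    then have "(restrict \<omega> {0..<t}, y) \<in> space (PiM {0..<t} (\<lambda>_. SX \<Otimes>\<^sub>M SA) \<Otimes>\<^sub>M SX)"
      using traj_space[OF x \<pi> \<omega>] by (auto simp: space_PiM space_pair_measure mem_Times_iff)
    then have "\<pi> t (restrict \<omega> {0..<t}, y) \<in> space (prob_algebra SA)"
      using \<pi> by (auto simp: policies_def dest: measurable_space)
    then show "(\<integral>\<^sup>+a. W y \<partial>\<pi> t (restrict \<omega> {0..<t}, y)) = W y"
      by (simp add: space_prob_algebra prob_space.emeasure_space_1)
  qed
  finally show ?thesis .
qed

lemma nn_integral_traj_0: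
  assumes x: "x \<in> X" and \<pi>: "\<pi> \<in> policies"
    and W [measurable]: "W \<in> borel_measurable SX"
  shows "(\<integral>\<^sup>+\<omega>. W (fst (\<omega> 0)) \<partial>traj \<pi> x) = W x"
proof -
  interpret T: prob_space "traj \<pi> x" by (rule prob_space_traj) fact+
  show ?thesis
    using x by (subst nn_integral_traj_state[OF x \<pi> W]) (simp add: nn_integral_return T.emeasure_space_1)
qed

lemma next_state_measurable:
  assumes "y \<in> X" "t \<ge> 1"
  shows "(\<lambda>w. y - D t w) \<in> M \<rightarrow>\<^sub>M SX"
proof -
  have "(0::real) \<in> A" using spaces by auto
  then have "(\<lambda>w. y - D t w) \<in> space M \<rightarrow> X"
    using next_state_in_X[of y 0 _ "t - 1"] assms by auto
  moreover have "D t \<in> borel_measurable M" using assms D_measurable by auto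
  then have "(\<lambda>w. y - D t w) \<in> borel_measurable M" by measurable
  ultimately show ?thesis unfolding SX_def by (intro measurable_restrict_space2)
qed

lemma plus_in_X: "x \<in> X \<Longrightarrow> a \<in> A \<Longrightarrow> x + a \<in> X"
  using spaces Nats_subset_Ints by auto

lemma minus_demand_in_X: "x \<in> X \<Longrightarrow> w \<in> space M \<Longrightarrow> x - D 1 w \<in> X"
  using next_state_measurable[of x 1] by (auto dest: measurable_space)

text \<open>Equality of the demand laws is given on the Borel sets of the line, but the next state
  lives in \<open>SX\<close>. The two are related by writing the law of the next state as the
  restriction to the Borel set \<open>X\<close> of an image of the demand law.\<close>

lemma nn_integral_demand_cong:
  assumes y: "y \<in> X" and t: "t \<ge> 1" and W: "W \<in> borel_measurable SX"
  shows "(\<integral>\<^sup>+w. W (y - D t w) \<partial>M) = (\<integral>\<^sup>+w. W (y - D 1 w) \<partial>M)"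
proof -
  have "distr M SX (\<lambda>w. y - D s w) = restrict_space (distr (distr M borel (D s)) borel (\<lambda>d. y - d)) X"
    if s: "s \<ge> 1" for s
  proof (rule measure_eqI)
    fix B assume "B \<in> sets (distr M SX (\<lambda>w. y - D s w))"
    then have B: "B \<in> sets SX" by simp
    have [measurable]: "D s \<in> borel_measurable M" using s by (rule D_measurable)
    have X: "X \<in> sets borel" using spaces by auto
    then have B': "B \<in> sets borel" "B \<subseteq> X"
      using B by (auto simp: SX_def sets_restrict_space_iff)
    show "emeasure (distr M SX (\<lambda>w. y - D s w)) B =
      emeasure (restrict_space (distr (distr M borel (D s)) borel (\<lambda>d. y - d)) X) B"
      using B B' X
      by (simp add: emeasure_distr[OF next_state_measurable[OF y s]] emeasure_restrict_space distr_distr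
          comp_def emeasure_distr)
  qed (simp add: SX_def sets_restrict_space)
  then have "distr M SX (\<lambda>w. y - D t w) = distr M SX (\<lambda>w. y - D 1 w)"
    using t by (simp add: D_ident[OF t])
  then have "(\<integral>\<^sup>+z. W z \<partial>distr M SX (\<lambda>w. y - D t w)) = (\<integral>\<^sup>+z. W z \<partial>distr M SX (\<lambda>w. y - D 1 w))"
    by simp
  then show ?thesis
    using W next_state_measurable[OF y] t by (simp add: nn_integral_distr)
qed

text \<open>Turns one-step inequalities into inequalities along trajectories: whatever the policy,
  the next state depends on the past only through the current state-action pair.\<close>

lemma nn_integral_traj_Suc:
  assumes x: "x \<in> X" and \<pi>: "\<pi> \<in> policies"
    and W [measurable]: "W \<in> borel_measurable SX"
  shows "(\<integral>\<^sup>+\<omega>. W (fst (\<omega> (Suc t))) \<partial>traj \<pi> x) =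
    (\<integral>\<^sup>+\<omega>. (\<integral>\<^sup>+w. W (fst (\<omega> t) + snd (\<omega> t) - D 1 w) \<partial>M) \<partial>traj \<pi> x)"
proof (subst nn_integral_traj_state[OF x \<pi> W], rule nn_integral_cong)
  fix \<omega> assume "\<omega> \<in> space (traj \<pi> x)"
  then have y: "fst (\<omega> t) + snd (\<omega> t) \<in> X"
    using traj_space[OF x \<pi>] plus_in_X by blast
  show "(\<integral>\<^sup>+y. W y \<partial>state_law x (Suc t) \<omega>) =
    (\<integral>\<^sup>+w. W (fst (\<omega> t) + snd (\<omega> t) - D 1 w) \<partial>M)"
    using nn_integral_demand_cong[OF y _ W, of "Suc t"] next_state_measurable[OF y, of "Suc t"]
    by (simp add: nn_integral_distr)
qed

text \<open>Deterministic stationary policies. All upper bounds on values are obtained from policies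
  of this form; lower bounds treat every policy in \<open>policies\<close>.\<close>

definition markov :: "(real \<Rightarrow> real) \<Rightarrow> nat \<Rightarrow> (nat \<Rightarrow> real \<times> real) \<times> real \<Rightarrow> real measure" where
  "markov f t p = return SA (f (snd p))"

lemma markov_policy:
  assumes "f \<in> SX \<rightarrow>\<^sub>M SA"
  shows "markov f \<in> policies"
  unfolding policies_def markov_def
  by (clarify, rule measurable_compose[OF measurable_compose[OF measurable_snd assms] measurable_return_prob_space])

text \<open>The probability of a deviation at time \<open>t\<close> is an integral whose innermost
  kernel is the point mass at the prescribed action, hence zero.\<close>

lemma AE_markov:
  assumes x: "x \<in> X" and f [measurable]: "f \<in> SX \<rightarrow>\<^sub>M SA"
  shows "AE \<omega> in traj (markov f) x. snd (\<omega> t) = f (fst (\<omega> t))"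
proof -
  have \<pi>: "markov f \<in> policies" by (rule markov_policy) fact
  let ?B = "{p \<in> space (SX \<Otimes>\<^sub>M SA). snd p \<noteq> f (fst p)}"
  have id: "(\<lambda>a. a) \<in> borel_measurable SA" by (simp add: SA_def measurable_restrict_space1)
  have [measurable]: "(\<lambda>p. snd p) \<in> borel_measurable (SX \<Otimes>\<^sub>M SA)"
    "(\<lambda>p. f (fst p)) \<in> borel_measurable (SX \<Otimes>\<^sub>M SA)"
    using measurable_compose[OF _ id] by measurable
  have B [measurable]: "?B \<in> sets (SX \<Otimes>\<^sub>M SA)" by measurable
  have "(\<integral>\<^sup>+\<omega>. indicator ?B (\<omega> t) \<partial>traj (markov f) x) =
     (\<integral>\<^sup>+\<omega>. (\<integral>\<^sup>+y. (\<integral>\<^sup>+a. indicator ?B (y, a) \<partial>markov f t (restrict \<omega> {0..<t}, y)) \<partial>state_law x t \<omega>) \<partial>traj (markov f) x)"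
    by (rule nn_integral_traj[OF x \<pi>]) measurable
  also have "\<dots> = (\<integral>\<^sup>+\<omega>. (\<integral>\<^sup>+y. 0 \<partial>state_law x t \<omega>) \<partial>traj (markov f) x)"
  proof (intro nn_integral_cong)
    fix \<omega> y assume \<omega>: "\<omega> \<in> space (traj (markov f) x)" and y: "y \<in> space (state_law x t \<omega>)"
    have "state_law x t \<omega> = state_law x t (restrict \<omega> {0..<t})"
      by (rule state_law_cong) simp
    then have y: "y \<in> space SX"
      using y state_law_in[OF x \<omega> \<pi>, of t] by (auto simp: space_prob_algebra dest: sets_eq_imp_space_eq)
    then show "(\<integral>\<^sup>+a. indicator ?B (y, a) \<partial>markov f t (restrict \<omega> {0..<t}, y)) = (0::ennreal)"
      using measurable_space[OF f y] unfolding markov_def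
      by (subst nn_integral_return) auto
  qed
  finally have "(\<integral>\<^sup>+\<omega>. indicator ?B (\<omega> t) \<partial>traj (markov f) x) = 0" by simp
  then have "AE \<omega> in traj (markov f) x. indicator ?B (\<omega> t) = (0::ennreal)"
    by (subst (asm) nn_integral_0_iff_AE)
     (auto intro!: measurable_compose[OF traj_component_measurable[OF x \<pi>]])
  then show ?thesis
    using measurable_space[OF traj_component_measurable[OF x \<pi>, of t]]
    by (auto split: split_indicator_asm)
qed

subsection \<open>Sub- and supersolutions of the optimality equation\<close>

definition EH :: "real \<Rightarrow> real" where
  "EH y = expectation (\<lambda>\<omega>. h (y - D 1 \<omega>))"

text \<open>The argument is the stock after ordering and before demand; the transition depends on
  state and action through this level only.\<close>

definition mean_next :: "(real \<Rightarrow> ennreal) \<Rightarrow> real \<Rightarrow> ennreal" where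
  "mean_next W y = (\<integral>\<^sup>+\<omega>. W (y - D 1 \<omega>) \<partial>M)"

definition stage_cost ::
    "(nat \<Rightarrow> (nat \<Rightarrow> real \<times> real) \<times> real \<Rightarrow> real measure) \<Rightarrow> real \<Rightarrow> nat \<Rightarrow> ennreal" where
  "stage_cost \<pi> x t = (\<integral>\<^sup>+\<omega>. ennreal (cost (fst (\<omega> t)) (snd (\<omega> t))) \<partial>traj \<pi> x)"

lemma A_nonneg: "a \<in> A \<Longrightarrow> 0 \<le> a"
  using spaces by (auto simp: Nats_def)

lemma EH_nonneg: "y \<in> X \<Longrightarrow> 0 \<le> EH y"
  unfolding EH_def by (rule Eh_nonneg)

lemma EH_measurable: "EH \<in> borel_measurable SX"
  using borel_measurable_continuous_on_restrict[OF Eh_continuous] unfolding SX_def EH_def[abs_def] .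

lemma cost_eq: "cost y a = K * (if a > 0 then 1 else 0) + cbar * a + EH (y + a)"
  by (simp add: cost_def EH_def)

lemma plus_measurable: "(\<lambda>p. fst p + snd p) \<in> SX \<Otimes>\<^sub>M SA \<rightarrow>\<^sub>M SX"
proof -
  have "(\<lambda>p. fst p + snd p) \<in> SX \<Otimes>\<^sub>M SA \<rightarrow>\<^sub>M restrict_space borel X"
    by (intro measurable_restrict_space2 fst_plus_snd_measurable)
      (auto simp: space_pair_measure intro: plus_in_X)
  then show ?thesis by (simp add: SX_def)
qed

lemma demand_measurable: "(\<lambda>p. fst p - D 1 (snd p)) \<in> SX \<Otimes>\<^sub>M M \<rightarrow>\<^sub>M SX"
proof -
  have [measurable]: "(\<lambda>x. x) \<in> borel_measurable SX" "D 1 \<in> borel_measurable M"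
    by (simp_all add: SX_def measurable_restrict_space1 D_measurable)
  have "(\<lambda>p. fst p - D 1 (snd p)) \<in> borel_measurable (SX \<Otimes>\<^sub>M M)"
    by measurable
  then have "(\<lambda>p. fst p - D 1 (snd p)) \<in> SX \<Otimes>\<^sub>M M \<rightarrow>\<^sub>M restrict_space borel X"
    using minus_demand_in_X
    by (intro measurable_restrict_space2) (auto simp: space_pair_measure simp del: One_nat_def)
  then show ?thesis by (simp add: SX_def)
qed

lemma cost_measurable: "(\<lambda>p. cost (fst p) (snd p)) \<in> borel_measurable (SX \<Otimes>\<^sub>M SA)"
proof -
  have [measurable]: "(\<lambda>a. a) \<in> borel_measurable SA"
    by (simp add: SA_def measurable_restrict_space1)
  have [measurable]: "(\<lambda>p. EH (fst p + snd p)) \<in> borel_measurable (SX \<Otimes>\<^sub>M SA)"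
    by (rule measurable_compose[OF plus_measurable EH_measurable])
  show ?thesis unfolding cost_eq by measurable
qed

lemma mean_next_measurable:
  assumes "W \<in> borel_measurable SX"
  shows "mean_next W \<in> borel_measurable SX"
proof -
  have "(\<lambda>(y, \<omega>). W (y - D 1 \<omega>)) \<in> borel_measurable (SX \<Otimes>\<^sub>M M)"
    using measurable_compose[OF demand_measurable assms] by (simp add: case_prod_beta')
  then show ?thesis
    unfolding mean_next_def[abs_def] by (rule borel_measurable_nn_integral)
qed

lemma mean_next_mono:
  assumes "y \<in> X" "\<And>z. z \<in> X \<Longrightarrow> z \<le> y \<Longrightarrow> V z \<le> W z"
  shows "mean_next V y \<le> mean_next W y"
  unfolding mean_next_def
proof (rule nn_integral_mono)
  fix \<omega> assume "\<omega> \<in> space M"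
  then show "V (y - D 1 \<omega>) \<le> W (y - D 1 \<omega>)"
    using assms D_nonneg[of 1 \<omega>] minus_demand_in_X[of y \<omega>] by simp
qed

lemma next_measurable:
  assumes "W \<in> borel_measurable SX" "y \<in> X"
  shows "(\<lambda>\<omega>. W (y - D 1 \<omega>)) \<in> borel_measurable M"
  by (rule measurable_compose[OF next_state_measurable assms(1)]) (use assms in auto)

lemma disc_value_pol_eq:
  assumes "x \<in> X" "\<pi> \<in> policies" "0 \<le> \<alpha>"
  shows "disc_value_pol \<alpha> \<pi> x = (\<Sum>t. ennreal (\<alpha> ^ t) * stage_cost \<pi> x t)"
proof -
  have [measurable]: "(\<lambda>\<omega>. cost (fst (\<omega> t)) (snd (\<omega> t))) \<in> borel_measurable (traj \<pi> x)" for t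
    by (rule measurable_compose[OF traj_component_measurable[OF assms(1,2)] cost_measurable])
  have "disc_value_pol \<alpha> \<pi> x =
    (\<Sum>t. \<integral>\<^sup>+\<omega>. ennreal (\<alpha> ^ t * cost (fst (\<omega> t)) (snd (\<omega> t))) \<partial>traj \<pi> x)"
    unfolding disc_value_pol_def by (rule nn_integral_suminf) measurable
  also have "\<dots> = (\<Sum>t. ennreal (\<alpha> ^ t) * stage_cost \<pi> x t)"
    using assms(3) unfolding stage_cost_def by (simp add: ennreal_mult' nn_integral_cmult)
  finally show ?thesis .
qed

lemma avg_value_pol_eq:
  assumes "x \<in> X" "\<pi> \<in> policies"
  shows "avg_value_pol \<pi> x = limsup (\<lambda>N. ennreal (1 / real N) * (\<Sum>t<N. stage_cost \<pi> x t))"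
proof -
  have [measurable]: "(\<lambda>\<omega>. cost (fst (\<omega> t)) (snd (\<omega> t))) \<in> borel_measurable (traj \<pi> x)" for t
    by (rule measurable_compose[OF traj_component_measurable[OF assms(1,2)] cost_measurable])
  show ?thesis
    unfolding avg_value_pol_def stage_cost_def by (subst nn_integral_sum) auto
qed

lemma subsolution_le_partial_sum:
  assumes x: "x \<in> X" and \<pi>: "\<pi> \<in> policies" and \<alpha>: "0 \<le> \<alpha>"
    and W [measurable]: "W \<in> borel_measurable SX"
    and sub: "\<And>y a. y \<in> X \<Longrightarrow> a \<in> A \<Longrightarrow> W y \<le> ennreal (cost y a) + ennreal \<alpha> * mean_next W (y + a)"
  shows "W x \<le> (\<Sum>t<n. ennreal (\<alpha> ^ t) * stage_cost \<pi> x t) +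
    ennreal (\<alpha> ^ n) * (\<integral>\<^sup>+\<omega>. W (fst (\<omega> n)) \<partial>traj \<pi> x)"
proof (induction n)
  case 0
  show ?case by (simp add: nn_integral_traj_0[OF x \<pi> W])
next
  case (Suc n)
  have [measurable]: "(\<lambda>\<omega>. cost (fst (\<omega> t)) (snd (\<omega> t))) \<in> borel_measurable (traj \<pi> x)" for t
    by (rule measurable_compose[OF traj_component_measurable[OF x \<pi>] cost_measurable])
  have [measurable]: "(\<lambda>\<omega>. mean_next W (fst (\<omega> t) + snd (\<omega> t))) \<in> borel_measurable (traj \<pi> x)" for t
    by (rule measurable_compose[OF traj_component_measurable[OF x \<pi>]
          measurable_compose[OF plus_measurable mean_next_measurable[OF W]]])
  have "(\<integral>\<^sup>+\<omega>. W (fst (\<omega> n)) \<partial>traj \<pi> x) \<le>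
    (\<integral>\<^sup>+\<omega>. ennreal (cost (fst (\<omega> n)) (snd (\<omega> n))) +
      ennreal \<alpha> * mean_next W (fst (\<omega> n) + snd (\<omega> n)) \<partial>traj \<pi> x)"
    using traj_space[OF x \<pi>] by (intro nn_integral_mono sub)
  also have "\<dots> = stage_cost \<pi> x n + ennreal \<alpha> * (\<integral>\<^sup>+\<omega>. W (fst (\<omega> (Suc n))) \<partial>traj \<pi> x)"
    unfolding stage_cost_def nn_integral_traj_Suc[OF x \<pi> W] mean_next_def[symmetric]
    by (simp add: nn_integral_add nn_integral_cmult)
  finally have "ennreal (\<alpha> ^ n) * (\<integral>\<^sup>+\<omega>. W (fst (\<omega> n)) \<partial>traj \<pi> x) \<le>
    ennreal (\<alpha> ^ n) * stage_cost \<pi> x n +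
    ennreal (\<alpha> ^ Suc n) * (\<integral>\<^sup>+\<omega>. W (fst (\<omega> (Suc n))) \<partial>traj \<pi> x)"
    using \<alpha> mult_left_mono[of _ _ "ennreal (\<alpha> ^ n)"]
    by (fastforce simp: distrib_left ennreal_mult mult_ac)
  then show ?case
    by (auto intro!: order_trans[OF Suc.IH] simp: add.assoc add_left_mono)
qed

text \<open>Iterating the inequality leaves a remainder \<open>\<alpha> ^ n\<close> times the mean
  of \<open>W\<close> at time \<open>n\<close>. If the policy has infinite cost there is nothing to
  show. Otherwise its discounted stage costs tend to 0, and the growth bound, which compares
  \<open>W\<close> with the stage cost itself, makes the remainder vanish for every such
  policy.\<close>

lemma subsolution_le_disc_value:
  assumes x: "x \<in> X" and \<alpha>: "0 \<le> \<alpha>" "\<alpha> < 1"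
    and W [measurable]: "W \<in> borel_measurable SX"
    and sub: "\<And>y a. y \<in> X \<Longrightarrow> a \<in> A \<Longrightarrow> W y \<le> ennreal (cost y a) + ennreal \<alpha> * mean_next W (y + a)"
    and growth: "\<And>y a. y \<in> X \<Longrightarrow> a \<in> A \<Longrightarrow> W y \<le> ennreal B * (1 + ennreal (cost y a))"
  shows "W x \<le> disc_value \<alpha> x"
  unfolding disc_value_def
proof (rule INF_greatest)
  fix \<pi> assume \<pi>: "\<pi> \<in> policies"
  interpret T: prob_space "traj \<pi> x" by (rule prob_space_traj) fact+
  let ?s = "\<lambda>t. ennreal (\<alpha> ^ t) * stage_cost \<pi> x t"
  have [measurable]: "(\<lambda>\<omega>. cost (fst (\<omega> t)) (snd (\<omega> t))) \<in> borel_measurable (traj \<pi> x)" for t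
    by (rule measurable_compose[OF traj_component_measurable[OF x \<pi>] cost_measurable])
  show "W x \<le> disc_value_pol \<alpha> \<pi> x"
  proof (cases "(\<Sum>t. ?s t) = \<infinity>")
    case True
    then show ?thesis by (simp add: disc_value_pol_eq[OF x \<pi> \<alpha>(1)])
  next
    case False
    have 0: "?s \<longlonglongrightarrow> 0"
    proof -
      have fin: "?s t \<noteq> \<infinity>" for t
        using False ennreal_suminf_lessD[of ?s \<infinity> t] by (auto simp: less_top)
      then have s: "?s t = ennreal (enn2real (?s t))" for t
        by (metis ennreal_enn2real infinity_ennreal_def less_top)
      then have "(\<Sum>t. ennreal (enn2real (?s t))) \<noteq> top"
        using False by (simp add: s[symmetric])
      then have "(\<lambda>t. enn2real (?s t)) \<longlonglongrightarrow> 0"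
        by (intro summable_LIMSEQ_zero summable_suminf_not_top) auto
      then show ?thesis
        using tendsto_ennrealI s by fastforce
    qed
    have "W x \<le> (\<Sum>t<n. ?s t) + ennreal B * (ennreal (\<alpha> ^ n) + ?s n)" for n
    proof -
      have "(\<integral>\<^sup>+\<omega>. W (fst (\<omega> n)) \<partial>traj \<pi> x) \<le>
        (\<integral>\<^sup>+\<omega>. ennreal B * (1 + ennreal (cost (fst (\<omega> n)) (snd (\<omega> n)))) \<partial>traj \<pi> x)"
        using traj_space[OF x \<pi>] by (intro nn_integral_mono growth)
      also have "\<dots> = ennreal B * (1 + stage_cost \<pi> x n)"
        unfolding stage_cost_def by (simp add: nn_integral_cmult nn_integral_add T.emeasure_space_1)
      finally have "ennreal (\<alpha> ^ n) * (\<integral>\<^sup>+\<omega>. W (fst (\<omega> n)) \<partial>traj \<pi> x) \<le>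
        ennreal B * (ennreal (\<alpha> ^ n) + ?s n)"
        using mult_left_mono[of _ _ "ennreal (\<alpha> ^ n)"] by (fastforce simp: distrib_left mult_ac)
      then show ?thesis
        using subsolution_le_partial_sum[OF x \<pi> \<alpha>(1) W sub, of n] by (meson add_left_mono order_trans)
    qed
    moreover have "(\<lambda>n. (\<Sum>t<n. ?s t) + ennreal B * (ennreal (\<alpha> ^ n) + ?s n))
      \<longlonglongrightarrow> (\<Sum>t. ?s t) + ennreal B * (ennreal 0 + 0)"
      using \<alpha> by (intro tendsto_add summable_LIMSEQ summableI ennreal_tendsto_cmult tendsto_ennrealI
          LIMSEQ_realpow_zero 0) auto
    ultimately show ?thesis
      unfolding disc_value_pol_eq[OF x \<pi> \<alpha>(1)] by (auto intro: LIMSEQ_le_const)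
  qed
qed

text \<open>The error \<epsilon> per period serves two uses: small errors of measurable selectors
  when \<alpha> < 1, and a bound on the average cost per period when \<alpha> = 1.\<close>

lemma partial_sum_le_supersolution:
  assumes x: "x \<in> X" and f: "f \<in> SX \<rightarrow>\<^sub>M SA" and \<alpha>: "0 \<le> \<alpha>"
    and W [measurable]: "W \<in> borel_measurable SX"
    and sup: "\<And>y. y \<in> X \<Longrightarrow> ennreal (cost y (f y)) + ennreal \<alpha> * mean_next W (y + f y) \<le> W y + \<epsilon>"
  shows "(\<Sum>t<n. ennreal (\<alpha> ^ t) * stage_cost (markov f) x t) +
      ennreal (\<alpha> ^ n) * (\<integral>\<^sup>+\<omega>. W (fst (\<omega> n)) \<partial>traj (markov f) x)
    \<le> W x + \<epsilon> * (\<Sum>t<n. ennreal (\<alpha> ^ t))"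
proof (induction n)
  case 0
  show ?case by (simp add: nn_integral_traj_0[OF x markov_policy[OF f] W])
next
  case (Suc n)
  have \<pi>: "markov f \<in> policies" by (rule markov_policy[OF f])
  interpret T: prob_space "traj (markov f) x" by (rule prob_space_traj) fact+
  have [measurable]: "(\<lambda>\<omega>. cost (fst (\<omega> t)) (snd (\<omega> t))) \<in> borel_measurable (traj (markov f) x)" for t
    by (rule measurable_compose[OF traj_component_measurable[OF x \<pi>] cost_measurable])
  have [measurable]: "(\<lambda>\<omega>. W (fst (\<omega> t))) \<in> borel_measurable (traj (markov f) x)" for t
    by (rule measurable_compose[OF traj_component_measurable[OF x \<pi>]]) measurable
  have [measurable]: "(\<lambda>\<omega>. mean_next W (fst (\<omega> t) + snd (\<omega> t))) \<in> borel_measurable (traj (markov f) x)" for t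
    by (rule measurable_compose[OF traj_component_measurable[OF x \<pi>]
          measurable_compose[OF plus_measurable mean_next_measurable[OF W]]])
  have "stage_cost (markov f) x n + ennreal \<alpha> * (\<integral>\<^sup>+\<omega>. W (fst (\<omega> (Suc n))) \<partial>traj (markov f) x) =
    (\<integral>\<^sup>+\<omega>. ennreal (cost (fst (\<omega> n)) (snd (\<omega> n))) +
      ennreal \<alpha> * mean_next W (fst (\<omega> n) + snd (\<omega> n)) \<partial>traj (markov f) x)"
    unfolding stage_cost_def nn_integral_traj_Suc[OF x \<pi> W] mean_next_def[symmetric]
    by (simp add: nn_integral_add nn_integral_cmult)
  also have "\<dots> \<le> (\<integral>\<^sup>+\<omega>. W (fst (\<omega> n)) + \<epsilon> \<partial>traj (markov f) x)"
  proof (rule nn_integral_mono_AE, use AE_markov[OF x f, of n] AE_space in eventually_elim)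
    fix \<omega> assume "snd (\<omega> n) = f (fst (\<omega> n))" "\<omega> \<in> space (traj (markov f) x)"
    then show "ennreal (cost (fst (\<omega> n)) (snd (\<omega> n))) +
      ennreal \<alpha> * mean_next W (fst (\<omega> n) + snd (\<omega> n)) \<le> W (fst (\<omega> n)) + \<epsilon>"
      using sup[of "fst (\<omega> n)"] traj_space[OF x \<pi>, of \<omega> n] by simp
  qed
  also have "\<dots> = (\<integral>\<^sup>+\<omega>. W (fst (\<omega> n)) \<partial>traj (markov f) x) + \<epsilon>"
    by (simp add: nn_integral_add T.emeasure_space_1)
  finally have "ennreal (\<alpha> ^ n) * stage_cost (markov f) x n +
      ennreal (\<alpha> ^ Suc n) * (\<integral>\<^sup>+\<omega>. W (fst (\<omega> (Suc n))) \<partial>traj (markov f) x)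
    \<le> ennreal (\<alpha> ^ n) * (\<integral>\<^sup>+\<omega>. W (fst (\<omega> n)) \<partial>traj (markov f) x) + \<epsilon> * ennreal (\<alpha> ^ n)"
    using \<alpha> mult_left_mono[of _ _ "ennreal (\<alpha> ^ n)"]
    by (fastforce simp: distrib_left ennreal_mult mult_ac)
  then have "(\<Sum>t<n. ennreal (\<alpha> ^ t) * stage_cost (markov f) x t) +
      (ennreal (\<alpha> ^ n) * stage_cost (markov f) x n +
      ennreal (\<alpha> ^ Suc n) * (\<integral>\<^sup>+\<omega>. W (fst (\<omega> (Suc n))) \<partial>traj (markov f) x))
    \<le> (\<Sum>t<n. ennreal (\<alpha> ^ t) * stage_cost (markov f) x t) +
      (ennreal (\<alpha> ^ n) * (\<integral>\<^sup>+\<omega>. W (fst (\<omega> n)) \<partial>traj (markov f) x) + \<epsilon> * ennreal (\<alpha> ^ n))"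
    by (rule add_left_mono)
  also have "\<dots> \<le> (W x + \<epsilon> * (\<Sum>t<n. ennreal (\<alpha> ^ t))) + \<epsilon> * ennreal (\<alpha> ^ n)"
    using add_right_mono[OF Suc.IH, of "\<epsilon> * ennreal (\<alpha> ^ n)"] by (simp add: add.assoc)
  finally show ?case by (simp add: distrib_left add.assoc)
qed

lemma disc_value_le_supersolution:
  assumes x: "x \<in> X" and \<alpha>: "0 \<le> \<alpha>" "\<alpha> < 1"
    and W: "W \<in> borel_measurable SX"
    and sup: "\<And>\<epsilon>. 0 < \<epsilon> \<Longrightarrow> \<exists>f \<in> SX \<rightarrow>\<^sub>M SA. \<forall>y\<in>X.
      ennreal (cost y (f y)) + ennreal \<alpha> * mean_next W (y + f y) \<le> W y + ennreal \<epsilon>"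
  shows "disc_value \<alpha> x \<le> W x"
proof (rule ennreal_le_epsilon)
  fix e :: real assume e: "0 < e"
  have g: "(\<Sum>t. ennreal (\<alpha> ^ t)) = ennreal (1 / (1 - \<alpha>))"
    using \<alpha> by (simp add: suminf_ennreal2 suminf_geometric summable_geometric)
  \<comment> \<open>An error \<epsilon> in each period accumulates to at most
    \<open>\<epsilon> / (1 - \<alpha>)\<close>, which is to equal \<open>e\<close>.\<close>
  define \<epsilon> where "\<epsilon> = e * (1 - \<alpha>)"
  have \<epsilon>: "0 < \<epsilon>" "\<epsilon> * (1 / (1 - \<alpha>)) = e" using e \<alpha> by (simp_all add: \<epsilon>_def)
  obtain f where f: "f \<in> SX \<rightarrow>\<^sub>M SA"
    and s: "\<And>y. y \<in> X \<Longrightarrow> ennreal (cost y (f y)) + ennreal \<alpha> * mean_next W (y + f y) \<le> W y + ennreal \<epsilon>"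
    using sup[OF \<epsilon>(1)] by blast
  have "(\<Sum>t<n. ennreal (\<alpha> ^ t) * stage_cost (markov f) x t) \<le> W x + ennreal e" for n
  proof -
    have "(\<Sum>t<n. ennreal (\<alpha> ^ t) * stage_cost (markov f) x t) \<le>
      (\<Sum>t<n. ennreal (\<alpha> ^ t) * stage_cost (markov f) x t) +
      ennreal (\<alpha> ^ n) * (\<integral>\<^sup>+\<omega>. W (fst (\<omega> n)) \<partial>traj (markov f) x)" by simp
    also have "\<dots> \<le> W x + ennreal \<epsilon> * (\<Sum>t<n. ennreal (\<alpha> ^ t))"
      by (rule partial_sum_le_supersolution[OF x f \<alpha>(1) W s])
    also have "\<dots> \<le> W x + ennreal \<epsilon> * ennreal (1 / (1 - \<alpha>))"
      unfolding g[symmetric] by (intro add_left_mono mult_left_mono sum_le_suminf) auto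
    also have "\<dots> = W x + ennreal e"
      using \<epsilon> \<alpha> by (simp add: ennreal_mult[symmetric])
    finally show ?thesis .
  qed
  then have "disc_value_pol \<alpha> (markov f) x \<le> W x + ennreal e"
    unfolding disc_value_pol_eq[OF x markov_policy[OF f] \<alpha>(1)]
    by (intro suminf_le_const summableI)
  then show "disc_value \<alpha> x \<le> W x + ennreal e"
    unfolding disc_value_def by (meson INF_lower2 markov_policy[OF f])
qed

subsection \<open>Value iteration\<close>

definition post :: "real \<Rightarrow> (real \<Rightarrow> ennreal) \<Rightarrow> real \<Rightarrow> ennreal" where
  "post \<alpha> W y = ennreal (EH y) + ennreal \<alpha> * mean_next W y"

text \<open>The minimization is over the level ordered up to, not the quantity, so that the state
  enters the infimum only through the ordering cost. Staying is a separate term because it avoids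
  \<open>K\<close>.\<close>

definition bellman :: "real \<Rightarrow> (real \<Rightarrow> ennreal) \<Rightarrow> real \<Rightarrow> ennreal" where
  "bellman \<alpha> W x =
     min (post \<alpha> W x) (INF y\<in>{y\<in>X. x < y}. ennreal (K + cbar * (y - x)) + post \<alpha> W y)"

lemma diff_in_A: "x \<in> X \<Longrightarrow> y \<in> X \<Longrightarrow> x \<le> y \<Longrightarrow> y - x \<in> A"
  using spaces by (auto simp: Nats_altdef1 elim!: Ints_cases) (metis of_int_diff diff_ge_0_iff_ge of_int_le_iff)

lemma post_mono:
  assumes "y \<in> X" "\<And>z. z \<in> X \<Longrightarrow> z \<le> y \<Longrightarrow> V z \<le> W z"
  shows "post \<alpha> V y \<le> post \<alpha> W y"
  unfolding post_def by (intro add_left_mono mult_left_mono mean_next_mono assms) auto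

lemma cost_stay: "ennreal (cost x 0) + ennreal \<alpha> * mean_next W (x + 0) = post \<alpha> W x"
  by (simp add: cost_eq post_def)

lemma cost_order:
  assumes "x \<in> X" "y \<in> X" "x < y"
  shows "ennreal (cost x (y - x)) + ennreal \<alpha> * mean_next W (x + (y - x)) =
    ennreal (K + cbar * (y - x)) + post \<alpha> W y"
proof -
  have "0 \<le> K + cbar * (y - x)" "0 \<le> EH y"
    using assms K_pos cbar_pos EH_nonneg by simp_all
  moreover have "cost x (y - x) = (K + cbar * (y - x)) + EH y" using assms by (simp add: cost_eq)
  ultimately have "ennreal (cost x (y - x)) = ennreal (K + cbar * (y - x)) + ennreal (EH y)"
    by (simp only: ennreal_plus)
  then show ?thesis by (simp add: post_def add.assoc)
qed

lemma bellman_le_post: "bellman \<alpha> W x \<le> post \<alpha> W x"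
  by (simp add: bellman_def)

lemma bellman_le_order:
  "y \<in> X \<Longrightarrow> x < y \<Longrightarrow> bellman \<alpha> W x \<le> ennreal (K + cbar * (y - x)) + post \<alpha> W y"
  unfolding bellman_def by (intro min.coboundedI2 INF_lower) simp

lemma bellman_le_cost:
  assumes "x \<in> X" "a \<in> A"
  shows "bellman \<alpha> W x \<le> ennreal (cost x a) + ennreal \<alpha> * mean_next W (x + a)"
proof (cases "a = 0")
  case True
  then show ?thesis using bellman_le_post cost_stay by metis
next
  case False
  then have "x < x + a" using A_nonneg[OF assms(2)] by simp
  then show ?thesis
    using bellman_le_order[of "x + a" x \<alpha> W] cost_order[of x "x + a" \<alpha> W] plus_in_X[OF assms] assms
    by simp
qed

lemma le_bellmanI:
  assumes "c \<le> post \<alpha> W x"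
    and "\<And>y. y \<in> X \<Longrightarrow> x < y \<Longrightarrow> c \<le> ennreal (K + cbar * (y - x)) + post \<alpha> W y"
  shows "c \<le> bellman \<alpha> W x"
  unfolding bellman_def using assms by (auto intro!: INF_greatest)

lemma bellman_mono:
  assumes "x \<in> X" "\<And>z. z \<in> X \<Longrightarrow> V z \<le> W z"
  shows "bellman \<alpha> V x \<le> bellman \<alpha> W x"
proof (rule le_bellmanI)
  show "bellman \<alpha> V x \<le> post \<alpha> W x"
    using assms by (intro order_trans[OF bellman_le_post post_mono])
  show "bellman \<alpha> V x \<le> ennreal (K + cbar * (y - x)) + post \<alpha> W y" if "y \<in> X" "x < y" for y
    using assms(2) by (intro order_trans[OF bellman_le_order[OF that] add_left_mono] post_mono that)
qed

text \<open>Gives both the measurability of \<open>bellman \<alpha> W\<close> and measurable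
  near-minimizers: the infimum is written over countably many measurable decision rules.\<close>

lemma bellman_enumeration:
  "\<exists>g :: nat \<Rightarrow> real \<Rightarrow> real. (\<forall>k. g k \<in> SX \<rightarrow>\<^sub>M SA) \<and>
    (\<forall>x\<in>X. bellman \<alpha> W x =
      (INF k. ennreal (cost x (g k x)) + ennreal \<alpha> * mean_next W (x + g k x)))"
proof -
  obtain Y where Y: "countable Y" "Y \<subseteq> X"
    "\<And>x. (INF y\<in>{y\<in>Y. x < y}. ennreal (K + cbar * (y - x)) + post \<alpha> W y) =
      (INF y\<in>{y\<in>X. x < y}. ennreal (K + cbar * (y - x)) + post \<alpha> W y)"
    using countable_subset_INF_ordering[of K cbar X "post \<alpha> W"] K_pos cbar_pos by (auto simp: less_imp_le)
  have "(0::real) \<in> X" using spaces by auto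
  define e where "e = from_nat_into (insert 0 Y)"
  have e: "range e = insert 0 Y" unfolding e_def using Y(1) by (intro range_from_nat_into) auto
  then have eX: "e k \<in> X" for k using Y(2) \<open>0 \<in> X\<close> by (metis insert_iff rangeI subsetD)
  \<comment> \<open>Rule 0 never orders; rule \<open>Suc i\<close> orders up to the
    \<open>i\<close>-th level, and stays if that level does not lie above the state, so every rule
    is admissible everywhere. The level 0 is inserted into \<open>Y\<close> only to have a nonempty
    set to enumerate.\<close>
  define g where "g k x = (case k of 0 \<Rightarrow> 0 | Suc i \<Rightarrow> if x < e i then e i - x else 0)" for k x
  have "(0::real) \<in> A" using spaces by auto
  show ?thesis
  proof (intro exI[of _ g] conjI allI ballI)
    fix k
    have [measurable]: "(\<lambda>x. x) \<in> borel_measurable SX"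
      by (simp add: SX_def measurable_restrict_space1)
    have "g k \<in> borel_measurable SX"
      unfolding g_def[abs_def] by (cases k) simp_all
    then show "g k \<in> SX \<rightarrow>\<^sub>M SA"
      unfolding SA_def using \<open>0 \<in> A\<close> eX
      by (intro measurable_restrict_space2) (auto simp: g_def diff_in_A split: nat.split)
  next
    fix x assume x: "x \<in> X"
    let ?v = "\<lambda>k. ennreal (cost x (g k x)) + ennreal \<alpha> * mean_next W (x + g k x)"
    show "bellman \<alpha> W x = (INF k. ?v k)"
    proof (rule antisym)
      have "g k x \<in> A" for k using \<open>0 \<in> A\<close> eX x by (auto simp: g_def diff_in_A split: nat.split)
      then show "bellman \<alpha> W x \<le> (INF k. ?v k)"
        by (intro INF_greatest bellman_le_cost x)
      have "(INF k. ?v k) \<le> ?v 0" by (rule INF_lower) simp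
      also have "\<dots> = post \<alpha> W x" unfolding g_def using cost_stay by simp
      finally have 1: "(INF k. ?v k) \<le> post \<alpha> W x" .
      have "(INF k. ?v k) \<le> ennreal (K + cbar * (y - x)) + post \<alpha> W y" if y: "y \<in> Y" "x < y" for y
      proof -
        obtain i where "e i = y" using e y by (metis insertCI rangeE)
        then have "g (Suc i) x = y - x" using y by (simp add: g_def)
        moreover have "(INF k. ?v k) \<le> ?v (Suc i)" by (rule INF_lower) simp
        ultimately show ?thesis using cost_order[of x y \<alpha> W] x y Y(2) by auto
      qed
      then show "(INF k. ?v k) \<le> bellman \<alpha> W x"
        using 1 unfolding bellman_def Y(3)[symmetric] by (auto intro!: INF_greatest)
    qed
  qed
qed

lemma action_value_measurable:
  assumes W: "W \<in> borel_measurable SX" and [measurable]: "f \<in> SX \<rightarrow>\<^sub>M SA"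
  shows "(\<lambda>x. ennreal (cost x (f x)) + ennreal \<alpha> * mean_next W (x + f x)) \<in> borel_measurable SX"
proof -
  have p: "(\<lambda>x. (x, f x)) \<in> SX \<rightarrow>\<^sub>M SX \<Otimes>\<^sub>M SA" by measurable
  have [measurable]: "(\<lambda>x. cost x (f x)) \<in> borel_measurable SX"
    using measurable_compose[OF p cost_measurable] by simp
  have [measurable]: "(\<lambda>x. mean_next W (x + f x)) \<in> borel_measurable SX"
    using measurable_compose[OF measurable_compose[OF p plus_measurable] mean_next_measurable[OF W]] by simp
  show ?thesis by measurable
qed

lemma bellman_measurable [measurable]:
  assumes "W \<in> borel_measurable SX"
  shows "bellman \<alpha> W \<in> borel_measurable SX"
proof -
  obtain g :: "nat \<Rightarrow> real \<Rightarrow> real" where g: "\<And>k. g k \<in> SX \<rightarrow>\<^sub>M SA"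
    "\<And>x. x \<in> X \<Longrightarrow> bellman \<alpha> W x =
      (INF k. ennreal (cost x (g k x)) + ennreal \<alpha> * mean_next W (x + g k x))"
    using bellman_enumeration[of \<alpha> W] by blast
  have "(\<lambda>x. INF k. ennreal (cost x (g k x)) + ennreal \<alpha> * mean_next W (x + g k x)) \<in> borel_measurable SX"
    by (intro borel_measurable_INF action_value_measurable[OF assms] g(1)) simp
  then show ?thesis
    by (rule measurable_cong[THEN iffD1, rotated]) (simp add: g(2))
qed

text \<open>The rule of least index within \<epsilon> of the infimum is used. Such an index exists
  when the infimum is finite because of the strict slack, and trivially when it is infinite.\<close>

lemma bellman_selector:
  assumes W: "W \<in> borel_measurable SX" and \<epsilon>: "0 < \<epsilon>"
  shows "\<exists>f\<in>SX \<rightarrow>\<^sub>M SA. \<forall>x\<in>X.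
    ennreal (cost x (f x)) + ennreal \<alpha> * mean_next W (x + f x) \<le> bellman \<alpha> W x + ennreal \<epsilon>"
proof -
  obtain g :: "nat \<Rightarrow> real \<Rightarrow> real" where g: "\<And>k. g k \<in> SX \<rightarrow>\<^sub>M SA"
    "\<And>x. x \<in> X \<Longrightarrow> bellman \<alpha> W x =
      (INF k. ennreal (cost x (g k x)) + ennreal \<alpha> * mean_next W (x + g k x))"
    using bellman_enumeration[of \<alpha> W] by blast
  let ?v = "\<lambda>k x. ennreal (cost x (g k x)) + ennreal \<alpha> * mean_next W (x + g k x)"
  let ?P = "\<lambda>k x. ?v k x \<le> bellman \<alpha> W x + ennreal \<epsilon>"
  define f where "f x = g (LEAST k. ?P k x) x" for x
  have ex: "\<exists>k. ?P k x" if x: "x \<in> X" for x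
  proof (cases "bellman \<alpha> W x = \<infinity>")
    case False
    then have "(INF k. ?v k x) < bellman \<alpha> W x + ennreal \<epsilon>"
      using \<epsilon> unfolding g(2)[OF x, symmetric] by (simp add: less_top)
    then show ?thesis unfolding INF_less_iff by (auto intro: less_imp_le)
  qed simp
  show ?thesis
  proof (intro bexI[of _ f] ballI)
    have [measurable]: "?v k \<in> borel_measurable SX" "bellman \<alpha> W \<in> borel_measurable SX" for k
      by (intro action_value_measurable[OF W] g(1) bellman_measurable[OF W])+
    have "(\<lambda>x. LEAST k. ?P k x) \<in> SX \<rightarrow>\<^sub>M count_space UNIV"
      by measurable
    then show "f \<in> SX \<rightarrow>\<^sub>M SA"
      unfolding f_def[abs_def] by (rule measurable_compose_countable[OF g(1)])
    show "ennreal (cost x (f x)) + ennreal \<alpha> * mean_next W (x + f x) \<le> bellman \<alpha> W x + ennreal \<epsilon>"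
      if "x \<in> X" for x
      unfolding f_def using ex[OF that] by (rule LeastI_ex)
  qed
qed

text \<open>Value iteration is started from above: a decreasing sequence of integrable functions
  converges to a fixed point of the Bellman operator by monotone convergence, whereas iteration
  from \<open>0\<close> would require an additional compactness argument.\<close>

lemma
  assumes \<alpha>: "0 \<le> \<alpha>" "\<alpha> < 1"
    and U: "U \<in> borel_measurable SX"
    and super: "\<And>y. y \<in> X \<Longrightarrow> bellman \<alpha> U y \<le> U y"
    and fin: "\<And>y. y \<in> X \<Longrightarrow> mean_next U y < \<infinity>"
    and growth: "\<And>y a. y \<in> X \<Longrightarrow> a \<in> A \<Longrightarrow> U y \<le> ennreal B * (1 + ennreal (cost y a))"
  shows disc_value_eq_value_iteration:
      "\<And>x. x \<in> X \<Longrightarrow> disc_value \<alpha> x = (INF n. (bellman \<alpha> ^^ n) U x)"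
    and disc_value_le_post:
      "\<And>x. x \<in> X \<Longrightarrow> disc_value \<alpha> x \<le> post \<alpha> (disc_value \<alpha>) x"
proof -
  define w where "w n = (bellman \<alpha> ^^ n) U" for n
  define W where "W y = (INF n. w n y)" for y
  have w [measurable]: "w n \<in> borel_measurable SX" for n
    unfolding w_def by (induction n) (simp_all add: U bellman_measurable)
  have W_meas [measurable]: "W \<in> borel_measurable SX" unfolding W_def[abs_def] by measurable
  have dec: "w (Suc n) y \<le> w n y" if "y \<in> X" for n y
    using that by (induction n arbitrary: y) (auto simp: w_def super intro: bellman_mono)
  have W_le: "W y \<le> w n y" for n y unfolding W_def by (rule INF_lower) simp
  have mean_W: "mean_next W y = (INF n. mean_next (w n) y)" if y: "y \<in> X" for y
    unfolding mean_next_def W_def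
  proof (rule nn_integral_monotone_convergence_INF_AE)
    show "AE \<omega> in M. w (Suc n) (y - D 1 \<omega>) \<le> w n (y - D 1 \<omega>)" for n
      using dec minus_demand_in_X[OF y] by (intro AE_I2) blast
    show "(\<lambda>\<omega>. w n (y - D 1 \<omega>)) \<in> borel_measurable M" for n
      by (rule next_measurable[OF w y])
    show "(\<integral>\<^sup>+\<omega>. w 0 (y - D 1 \<omega>) \<partial>M) < \<infinity>"
      using fin[OF y] by (simp add: w_def mean_next_def)
  qed
  \<comment> \<open>The limit is taken for one fixed action, so no exchange of the limit in
    \<open>n\<close> with the infimum over actions is involved.\<close>
  have W_sub: "W y \<le> ennreal (cost y a) + ennreal \<alpha> * mean_next W (y + a)" if y: "y \<in> X" "a \<in> A" for y a
  proof -
    have ya: "y + a \<in> X" using y by (rule plus_in_X)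
    have "(\<lambda>n. mean_next (w n) (y + a)) \<longlonglongrightarrow> mean_next W (y + a)"
      unfolding mean_W[OF ya]
      by (intro LIMSEQ_INF decseq_SucI mean_next_mono ya dec)
    then have "(\<lambda>n. ennreal (cost y a) + ennreal \<alpha> * mean_next (w n) (y + a))
      \<longlonglongrightarrow> ennreal (cost y a) + ennreal \<alpha> * mean_next W (y + a)"
      by (intro tendsto_add tendsto_const ennreal_tendsto_cmult) simp_all
    moreover have "W y \<le> ennreal (cost y a) + ennreal \<alpha> * mean_next (w n) (y + a)" for n
      using W_le[of y "Suc n"] bellman_le_cost[OF y, of \<alpha> "w n"] by (auto simp: w_def)
    ultimately show ?thesis by (auto intro: LIMSEQ_le_const)
  qed
  have W_super: "bellman \<alpha> W y \<le> W y" if y: "y \<in> X" for y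
    unfolding W_def[of y]
  proof (rule INF_greatest)
    fix n
    have "bellman \<alpha> W y \<le> w (Suc n) y"
      using bellman_mono[OF y W_le] by (simp add: w_def)
    then show "bellman \<alpha> W y \<le> w n y" using dec[OF y] by (rule order_trans)
  qed
  have "disc_value \<alpha> x \<le> W x" if x: "x \<in> X" for x
  proof (rule disc_value_le_supersolution[OF x \<alpha> W_meas])
    fix \<epsilon> :: real assume "0 < \<epsilon>"
    then obtain f where "f \<in> SX \<rightarrow>\<^sub>M SA"
      "\<And>x. x \<in> X \<Longrightarrow>
        ennreal (cost x (f x)) + ennreal \<alpha> * mean_next W (x + f x) \<le> bellman \<alpha> W x + ennreal \<epsilon>"
      using bellman_selector[OF W_meas, of \<epsilon> \<alpha>] by blast
    then show "\<exists>f\<in>SX \<rightarrow>\<^sub>M SA. \<forall>y\<in>X.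
        ennreal (cost y (f y)) + ennreal \<alpha> * mean_next W (y + f y) \<le> W y + ennreal \<epsilon>"
      using W_super by (meson add_right_mono order_trans)
  qed
  moreover have "W x \<le> disc_value \<alpha> x" if x: "x \<in> X" for x
  proof (rule subsolution_le_disc_value[OF x \<alpha> W_meas W_sub])
    show "W y \<le> ennreal B * (1 + ennreal (cost y a))" if "y \<in> X" "a \<in> A" for y a
      using growth[OF that] W_le[of y 0] by (auto simp: w_def)
  qed
  ultimately have eq: "disc_value \<alpha> x = W x" if "x \<in> X" for x
    using that by (intro antisym)
  then show "disc_value \<alpha> x = (INF n. (bellman \<alpha> ^^ n) U x)" if "x \<in> X" for x
    using that by (simp add: W_def w_def)
  have "(0::real) \<in> A" using spaces by auto
  show "disc_value \<alpha> x \<le> post \<alpha> (disc_value \<alpha>) x" if x: "x \<in> X" for x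
    using W_sub[OF x \<open>0 \<in> A\<close>] post_mono[OF x, of W "disc_value \<alpha>"] eq x
    unfolding cost_stay by (auto intro: order_trans)
qed

section \<open>Inequalities preserved by the Bellman operator\<close>

lemma mean_D_nonneg: "0 \<le> expectation (D 1)"
  using D_nonneg[of 1] by (intro Bochner_Integration.integral_nonneg) auto

lemma mean_next_affine:
  assumes "0 \<le> p" "0 \<le> q"
  shows "(\<integral>\<^sup>+\<omega>. ennreal (p + q * D 1 \<omega>) \<partial>M) = ennreal (p + q * expectation (D 1))"
proof -
  have "(\<integral>\<^sup>+\<omega>. ennreal (p + q * D 1 \<omega>) \<partial>M) = ennreal (expectation (\<lambda>\<omega>. p + q * D 1 \<omega>))"
    using assms D_integrable D_nonneg[of 1] by (intro nn_integral_eq_integral) auto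
  then show ?thesis using D_integrable by (simp add: prob_space)
qed

text \<open>From \<open>x\<close> one can order straight to whatever level is chosen from
  \<open>z\<close>. If that choice is itself an order, merging the two orders saves one
  \<open>K\<close>.\<close>

lemma bellman_le_order_up:
  assumes "x \<le> z" "z \<in> X"
  shows "bellman \<alpha> W x \<le> ennreal (K + cbar * (z - x)) + bellman \<alpha> W z"
proof (cases "x = z")
  case False
  then have xz: "x < z" using assms by simp
  let ?c = "ennreal (K + cbar * (z - x))"
  have "bellman \<alpha> W x \<le> ?c + post \<alpha> W z"
    by (rule bellman_le_order[OF assms(2) xz])
  moreover have "bellman \<alpha> W x \<le> ?c + (INF y\<in>{y\<in>X. z < y}. ennreal (K + cbar * (y - z)) + post \<alpha> W y)"
  proof -
    have "bellman \<alpha> W x \<le> ?c + (ennreal (K + cbar * (y - z)) + post \<alpha> W y)" if y: "y \<in> X" "z < y" for y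
    proof -
      have nonneg: "0 \<le> K + cbar * (z - x)" "0 \<le> K + cbar * (y - z)"
        using xz y K_pos cbar_pos by simp_all
      have "ennreal (K + cbar * (y - x)) \<le> ennreal ((K + cbar * (z - x)) + (K + cbar * (y - z)))"
        using K_pos by (intro ennreal_leI) (simp add: algebra_simps)
      also have "\<dots> = ?c + ennreal (K + cbar * (y - z))"
        using nonneg by (rule ennreal_plus)
      finally have "ennreal (K + cbar * (y - x)) + post \<alpha> W y \<le>
          ?c + (ennreal (K + cbar * (y - z)) + post \<alpha> W y)"
        unfolding add.assoc[symmetric] by (rule add_right_mono)
      moreover have "bellman \<alpha> W x \<le> ennreal (K + cbar * (y - x)) + post \<alpha> W y"
        using y xz by (intro bellman_le_order) auto
      ultimately show ?thesis by (rule order_trans[rotated])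
    qed
    then have "bellman \<alpha> W x - ?c \<le> (INF y\<in>{y\<in>X. z < y}. ennreal (K + cbar * (y - z)) + post \<alpha> W y)"
      by (intro INF_greatest) (auto simp: ennreal_minus_le_iff add.commute)
    then show ?thesis by (simp add: ennreal_minus_le_iff add.commute)
  qed
  ultimately show ?thesis
    unfolding bellman_def[of \<alpha> W z] by (simp add: min_def)
qed (simp add: add_increasing)

lemma mean_next_add_const:
  assumes "W \<in> borel_measurable SX" "y \<in> X"
  shows "(\<integral>\<^sup>+\<omega>. W (y - D 1 \<omega>) + c \<partial>M) = mean_next W y + c"
  unfolding mean_next_def using next_measurable[OF assms]
  by (subst nn_integral_add) (auto simp: emeasure_space_1)

text \<open>The invariant says that \<open>W x + cbar * x\<close> is nonincreasing up to
  \<open>b\<close>. It survives the expectation because demand only lowers the stock, so both next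
  states remain at or below \<open>b\<close>.\<close>

lemma bellman_antimono_transformed:
  assumes \<alpha>: "0 \<le> \<alpha>" "\<alpha> \<le> 1"
    and W: "W \<in> borel_measurable SX"
    and EH: "\<And>x x'. x \<in> X \<Longrightarrow> x' \<in> X \<Longrightarrow> x \<le> x' \<Longrightarrow> x' \<le> b \<Longrightarrow>
      EH x' + (1 - \<alpha>) * cbar * (x' - x) \<le> EH x"
    and IH: "\<And>x x'. x \<in> X \<Longrightarrow> x' \<in> X \<Longrightarrow> x \<le> x' \<Longrightarrow> x' \<le> b \<Longrightarrow>
      W x' + ennreal (cbar * (x' - x)) \<le> W x"
    and x: "x \<in> X" "x' \<in> X" "x \<le> x'" "x' \<le> b"
  shows "bellman \<alpha> W x' + ennreal (cbar * (x' - x)) \<le> bellman \<alpha> W x"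
proof -
  have post: "post \<alpha> W y' + ennreal (cbar * (y' - y)) \<le> post \<alpha> W y"
    if y: "y \<in> X" "y' \<in> X" "y \<le> y'" "y' \<le> b" for y y'
  proof -
    let ?c = "cbar * (y' - y)"
    have c: "0 \<le> ?c" using cbar_pos y by simp
    have c1: "0 \<le> (1 - \<alpha>) * ?c" by (rule mult_nonneg_nonneg[OF _ c]) (use \<alpha> in simp)
    have "mean_next W y' + ennreal ?c = (\<integral>\<^sup>+\<omega>. W (y' - D 1 \<omega>) + ennreal ?c \<partial>M)"
      by (rule mean_next_add_const[OF W y(2), symmetric])
    also have "\<dots> \<le> mean_next W y"
      unfolding mean_next_def
    proof (rule nn_integral_mono)
      fix \<omega> assume \<omega>: "\<omega> \<in> space M"
      then show "W (y' - D 1 \<omega>) + ennreal ?c \<le> W (y - D 1 \<omega>)"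
        using IH[of "y - D 1 \<omega>" "y' - D 1 \<omega>"] minus_demand_in_X[OF y(1) \<omega>] minus_demand_in_X[OF y(2) \<omega>]
          D_nonneg[of 1 \<omega>] y by simp
    qed
    finally have m: "mean_next W y' + ennreal ?c \<le> mean_next W y" .
    \<comment> \<open>The share \<open>1 - \<alpha>\<close> of the advantage is paid by the decrease
      of the transformed holding cost, the share \<alpha> by the discounted induction
      hypothesis.\<close>
    have "ennreal ?c = ennreal ((1 - \<alpha>) * ?c + \<alpha> * ?c)" by (simp add: left_diff_distrib)
    also have "\<dots> = ennreal ((1 - \<alpha>) * ?c) + ennreal (\<alpha> * ?c)"
      using c1 mult_nonneg_nonneg[OF \<alpha>(1) c] by (rule ennreal_plus)
    also have "ennreal (\<alpha> * ?c) = ennreal \<alpha> * ennreal ?c"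
      using \<alpha>(1) c by (rule ennreal_mult)
    finally have "post \<alpha> W y' + ennreal ?c =
      (ennreal (EH y') + ennreal ((1 - \<alpha>) * ?c)) + ennreal \<alpha> * (mean_next W y' + ennreal ?c)"
      unfolding post_def by (simp add: distrib_left ac_simps)
    also have "\<dots> \<le> ennreal (EH y) + ennreal \<alpha> * mean_next W y"
    proof (rule add_mono)
      have "ennreal (EH y') + ennreal ((1 - \<alpha>) * ?c) = ennreal (EH y' + (1 - \<alpha>) * ?c)"
        using EH_nonneg[OF y(2)] c1 by (rule ennreal_plus[symmetric])
      also have "\<dots> \<le> ennreal (EH y)"
        using EH[OF y] by (intro ennreal_leI) (simp add: mult.assoc)
      finally show "ennreal (EH y') + ennreal ((1 - \<alpha>) * ?c) \<le> ennreal (EH y)" .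
      show "ennreal \<alpha> * (mean_next W y' + ennreal ?c) \<le> ennreal \<alpha> * mean_next W y"
        by (rule mult_left_mono[OF m]) simp
    qed
    finally show ?thesis unfolding post_def .
  qed
  let ?c = "ennreal (cbar * (x' - x))"
  show ?thesis
  proof (rule le_bellmanI)
    show "bellman \<alpha> W x' + ?c \<le> post \<alpha> W x"
      using post[OF x] bellman_le_post add_right_mono order_trans by blast
    fix y assume y: "y \<in> X" "x < y"
    show "bellman \<alpha> W x' + ?c \<le> ennreal (K + cbar * (y - x)) + post \<alpha> W y"
    \<comment> \<open>An order from \<open>x\<close> beyond \<open>x'\<close> is imitated by an
      order from \<open>x'\<close> to the same level, saving exactly the unit cost of the
      difference. Otherwise \<open>x'\<close> already has the larger stock and stays; the comparison
      is then between the levels \<open>y\<close> and \<open>x'\<close>, both at most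
      \<open>b\<close>.\<close>
    proof (cases "x' < y")
      case True
      have "bellman \<alpha> W x' + ?c \<le> (ennreal (K + cbar * (y - x')) + post \<alpha> W y) + ?c"
        by (intro add_right_mono bellman_le_order y True)
      also have "\<dots> = (ennreal (K + cbar * (y - x')) + ?c) + post \<alpha> W y" by (simp add: ac_simps)
      also have "ennreal (K + cbar * (y - x')) + ?c = ennreal (K + cbar * (y - x))"
      proof -
        have "0 \<le> K + cbar * (y - x')" "0 \<le> cbar * (x' - x)" using True x K_pos cbar_pos by simp_all
        then show ?thesis by (subst ennreal_plus[symmetric]) (auto simp: algebra_simps)
      qed
      finally show ?thesis .
    next
      case False
      have nonneg: "0 \<le> cbar * (x' - y)" "0 \<le> cbar * (y - x)"
        using False y cbar_pos by simp_all
      have "?c = ennreal (cbar * (x' - y) + cbar * (y - x))" by (simp add: algebra_simps)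
      also have "\<dots> = ennreal (cbar * (x' - y)) + ennreal (cbar * (y - x))"
        using nonneg by (rule ennreal_plus)
      finally have c: "?c = ennreal (cbar * (x' - y)) + ennreal (cbar * (y - x))" .
      have "bellman \<alpha> W x' + ?c \<le> post \<alpha> W x' + ?c" by (intro add_right_mono bellman_le_post)
      also have "\<dots> = (post \<alpha> W x' + ennreal (cbar * (x' - y))) + ennreal (cbar * (y - x))"
        unfolding c by (simp only: ac_simps)
      also have "\<dots> \<le> post \<alpha> W y + ennreal (K + cbar * (y - x))"
        using False x y K_pos by (intro add_mono post ennreal_leI) auto
      finally show ?thesis by (simp add: add.commute)
    qed
  qed
qed

text \<open>The two stocks \<open>b\<close> and \<open>z\<close> face the same demand. Returning to
  a comparable position costs on average at most an extra
  \<open>K + cbar * expectation (D 1)\<close>, and this is the gap between the holding costs at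
  \<open>z\<close> and at \<open>b\<close>. The constant \<open>K + cbar * (B - b)\<close> is thus
  reproduced without growing from one iterate to the next.\<close>

lemma bellman_overstocked:
  assumes \<alpha>: "0 \<le> \<alpha>" "\<alpha> \<le> 1" and W: "W \<in> borel_measurable SX"
    and b: "b \<in> X" "b \<le> B"
    and EH: "\<And>y. y \<in> X \<Longrightarrow> B < y \<Longrightarrow> EH b + cbar * expectation (D 1) + K \<le> EH y"
    and order: "\<And>x z. x \<in> X \<Longrightarrow> z \<in> X \<Longrightarrow> x \<le> z \<Longrightarrow> W x \<le> ennreal (K + cbar * (z - x)) + W z"
    and IH: "\<And>y. y \<in> X \<Longrightarrow> B < y \<Longrightarrow> W b \<le> W y + ennreal (K + cbar * (B - b))"
    and y: "y \<in> X" "B < y"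
  shows "bellman \<alpha> W b \<le> bellman \<alpha> W y + ennreal (K + cbar * (B - b))"
proof -
  let ?C = "K + cbar * (B - b)"
  have C: "0 \<le> ?C" using K_pos cbar_pos b by simp
  have key: "bellman \<alpha> W b \<le> post \<alpha> W z + ennreal ?C" if z: "z \<in> X" "B < z" for z
  proof -
    have "mean_next W b \<le> (\<integral>\<^sup>+\<omega>. W (z - D 1 \<omega>) + ennreal (?C + K + cbar * D 1 \<omega>) \<partial>M)"
      unfolding mean_next_def
    proof (rule nn_integral_mono)
      fix \<omega> assume \<omega>: "\<omega> \<in> space M"
      have X: "b - D 1 \<omega> \<in> X" "z - D 1 \<omega> \<in> X" and D: "0 \<le> D 1 \<omega>"
        using minus_demand_in_X[OF _ \<omega>] b z D_nonneg[OF _ \<omega>, of 1] by auto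
      show "W (b - D 1 \<omega>) \<le> W (z - D 1 \<omega>) + ennreal (?C + K + cbar * D 1 \<omega>)"
      \<comment> \<open>If the larger stock is still above \<open>B\<close>, the smaller one is
        raised to \<open>b\<close> and the hypothesis applies there. Otherwise it is raised to the
        other stock, an amount of \<open>z - b\<close>, which is at most \<open>B - b\<close> plus
        the demand.\<close>
      proof (cases "B < z - D 1 \<omega>")
        case True
        have "W (b - D 1 \<omega>) \<le> ennreal (K + cbar * D 1 \<omega>) + W b"
          using order[OF X(1) b(1)] D by simp
        also have "\<dots> \<le> ennreal (K + cbar * D 1 \<omega>) + (W (z - D 1 \<omega>) + ennreal ?C)"
          by (intro add_left_mono IH X True)
        also have "\<dots> = W (z - D 1 \<omega>) + (ennreal ?C + ennreal (K + cbar * D 1 \<omega>))"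
          by (simp add: ac_simps)
        also have "ennreal ?C + ennreal (K + cbar * D 1 \<omega>) = ennreal (?C + K + cbar * D 1 \<omega>)"
          using C K_pos cbar_pos D by (subst ennreal_plus[symmetric]) (auto simp: add.assoc)
        finally show ?thesis .
      next
        case False
        have "W (b - D 1 \<omega>) \<le> ennreal (K + cbar * (z - D 1 \<omega> - (b - D 1 \<omega>))) + W (z - D 1 \<omega>)"
          using b z by (intro order X) auto
        also have "ennreal (K + cbar * (z - D 1 \<omega> - (b - D 1 \<omega>))) \<le> ennreal (?C + K + cbar * D 1 \<omega>)"
        proof (rule ennreal_leI)
          have "cbar * (z - b) \<le> cbar * (B - b + D 1 \<omega>)"
            using False cbar_pos by (intro mult_left_mono) auto
          then show "K + cbar * (z - D 1 \<omega> - (b - D 1 \<omega>)) \<le> ?C + K + cbar * D 1 \<omega>"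
            using K_pos by (simp add: distrib_left)
        qed
        finally show ?thesis by (simp add: add.commute add_right_mono)
      qed
    qed
    also have "\<dots> = mean_next W z + (\<integral>\<^sup>+\<omega>. ennreal (?C + K + cbar * D 1 \<omega>) \<partial>M)"
      unfolding mean_next_def using next_measurable[OF W z(1)] D_measurable[of 1]
      by (intro nn_integral_add) auto
    also have "(\<integral>\<^sup>+\<omega>. ennreal (?C + K + cbar * D 1 \<omega>) \<partial>M) = ennreal (?C + K + cbar * expectation (D 1))"
      using C K_pos cbar_pos by (intro mean_next_affine) auto
    finally have m: "mean_next W b \<le> mean_next W z + ennreal (?C + K + cbar * expectation (D 1))" .
    define r where "r = ?C + K + cbar * expectation (D 1)"
    have r: "0 \<le> r" using C K_pos cbar_pos mean_D_nonneg by (simp add: r_def)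
    have "ennreal \<alpha> * ennreal r \<le> 1 * ennreal r"
      using \<alpha> by (intro mult_right_mono) auto
    then have r': "ennreal \<alpha> * ennreal r \<le> ennreal r" by simp
    have "bellman \<alpha> W b \<le> ennreal (EH b) + ennreal \<alpha> * mean_next W b"
      using bellman_le_post unfolding post_def .
    also have "\<dots> \<le> ennreal (EH b) + ennreal \<alpha> * (mean_next W z + ennreal r)"
      unfolding r_def by (intro add_left_mono mult_left_mono m) simp
    also have "\<dots> \<le> ennreal (EH b) + (ennreal \<alpha> * mean_next W z + ennreal r)"
      unfolding distrib_left by (intro add_left_mono r')
    also have "\<dots> = ennreal \<alpha> * mean_next W z + (ennreal (EH b) + ennreal r)"
      by (simp only: ac_simps)
    also have "\<dots> \<le> ennreal \<alpha> * mean_next W z + (ennreal (EH z) + ennreal ?C)"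
    proof (rule add_left_mono)
      have "ennreal (EH b) + ennreal r = ennreal (EH b + r)"
        using EH_nonneg[OF b(1)] r by (rule ennreal_plus[symmetric])
      also have "\<dots> \<le> ennreal (EH z + ?C)"
        using EH[OF z] by (intro ennreal_leI) (simp add: r_def)
      also have "\<dots> = ennreal (EH z) + ennreal ?C"
        using EH_nonneg[OF z(1)] C by (rule ennreal_plus)
      finally show "ennreal (EH b) + ennreal r \<le> ennreal (EH z) + ennreal ?C" .
    qed
    finally show ?thesis unfolding post_def by (simp only: ac_simps)
  qed
  have "bellman \<alpha> W b - ennreal ?C \<le> bellman \<alpha> W y"
  proof (rule le_bellmanI)
    show "bellman \<alpha> W b - ennreal ?C \<le> post \<alpha> W y"
      using key[OF y] by (simp add: ennreal_minus_le_iff add.commute)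
    fix z assume z: "z \<in> X" "y < z"
    have "bellman \<alpha> W b - ennreal ?C \<le> post \<alpha> W z"
      using key[of z] y z by (simp add: ennreal_minus_le_iff add.commute)
    then show "bellman \<alpha> W b - ennreal ?C \<le> ennreal (K + cbar * (z - y)) + post \<alpha> W z"
      by (rule add_increasing[OF zero_le])
  qed
  then show ?thesis by (simp add: ennreal_minus_le_iff add.commute)
qed

section \<open>Levels determined by the holding cost\<close>

lemma Eh_disc_eq:
  assumes "y \<in> X"
  shows "Eh_disc \<alpha> y = EH y + (1 - \<alpha>) * cbar * (y - expectation (D 1)) + cbar * expectation (D 1)"
  unfolding Eh_disc_def h_disc_def EH_def
  using h_integrable[OF assms] D_integrable by (simp add: prob_space)

text \<open>Since the limit at the left end exceeds the infimum, some \<open>c\<close> has a value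
  below all values far to the left. Choosing \<open>b\<close> there, left of \<open>c\<close>,
  quasiconvexity excludes any increase below \<open>b\<close>.\<close>

lemma exists_decreasing_level:
  assumes quasiconvex: "quasiconvex_on X (Eh_disc \<alpha>)"
    and lim: "((\<lambda>x. ereal (Eh_disc \<alpha> x)) \<longlongrightarrow> L) (at_bot \<sqinter> principal X)"
    and L: "L > ereal K + (INF x\<in>X. ereal (Eh_disc \<alpha> x))"
  obtains b where "b \<in> X"
    "\<And>x y. x \<in> X \<Longrightarrow> y \<in> X \<Longrightarrow> x \<le> y \<Longrightarrow> y \<le> b \<Longrightarrow> Eh_disc \<alpha> y \<le> Eh_disc \<alpha> x"
proof -
  have "(INF x\<in>X. ereal (Eh_disc \<alpha> x)) \<le> ereal K + (INF x\<in>X. ereal (Eh_disc \<alpha> x))"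
    using K_pos by (cases "INF x\<in>X. ereal (Eh_disc \<alpha> x)") auto
  then have "(INF x\<in>X. ereal (Eh_disc \<alpha> x)) < L" using L by (rule le_less_trans)
  then obtain c where c: "c \<in> X" "ereal (Eh_disc \<alpha> c) < L" by (auto simp: INF_less_iff)
  have "eventually (\<lambda>x. x \<in> X \<longrightarrow> Eh_disc \<alpha> c < Eh_disc \<alpha> x) at_bot"
    using order_tendstoD(1)[OF lim c(2)] by (simp add: eventually_inf_principal)
  then obtain N where N: "\<And>x. x \<le> N \<Longrightarrow> x \<in> X \<Longrightarrow> Eh_disc \<alpha> c < Eh_disc \<alpha> x"
    by (auto simp: eventually_at_bot_linorder)
  \<comment> \<open>Rounding down keeps \<open>b\<close> in \<open>X\<close> in the integer variant
    as well; the offset 1 makes \<open>b < c\<close> strict.\<close>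
  define b where "b = real_of_int \<lfloor>min N (c - 1)\<rfloor>"
  have b: "b \<in> X" using spaces by (auto simp: b_def)
  have "b \<le> min N (c - 1)" unfolding b_def by (rule of_int_floor_le)
  then have "b \<le> N" "b < c" by auto
  then show ?thesis
    using that[OF b] quasiconvex_on_antimono[OF quasiconvex b c(1)] N b by blast
qed

lemma exists_costly_level:
  obtains B where "b \<le> B" "\<And>y. y \<in> X \<Longrightarrow> B < y \<Longrightarrow> Z \<le> EH y"
proof -
  have "eventually (\<lambda>x. Z \<le> EH x) (at_infinity \<sqinter> principal X)"
    using Eh_at_infinity unfolding filterlim_at_top EH_def by blast
  then obtain p where p: "\<And>x. p \<le> \<bar>x\<bar> \<Longrightarrow> x \<in> X \<Longrightarrow> Z \<le> EH x"
    by (auto simp: eventually_inf_principal eventually_at_infinity)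
  show ?thesis
    by (rule that[of "max b p"]) (auto intro!: p)
qed

end

subsection \<open>Ordering up to a fixed level\<close>

text \<open>The decrease of the transformed holding cost below \<open>b\<close> depends on the
  discount factor and is therefore passed to the individual lemmas as \<open>dec\<close>, while the
  locale fixes only what is common to all factors.\<close>

locale base_stock_inventory = inventory_model M D X A K cbar h
  for M :: "'w measure" and D X A K cbar h +
  fixes b :: real
  assumes b_in_X: "b \<in> X"
    and EH_quasiconvex: "quasiconvex_on X EH"
begin

text \<open>A charge per period for stock that starts at \<open>y\<close>, at or above
  \<open>b\<close>: by quasiconvexity the maximum bounds the holding cost at every level from
  \<open>b\<close> to \<open>y\<close>, and the remaining terms bound the mean cost of restoring
  \<open>b\<close> after one demand.\<close>

definition level_cost :: "real \<Rightarrow> real" where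
  "level_cost y = max (EH b) (EH y) + K + cbar * expectation (D 1)"

text \<open>An upper bound for the cost of ordering up to \<open>b\<close> whenever the inventory is below \<open>b\<close>.\<close>

definition base_bound :: "real \<Rightarrow> real \<Rightarrow> real" where
  "base_bound \<alpha> x = (if x < b then K + cbar * (b - x) else 0) + level_cost (max b x) / (1 - \<alpha>)"

lemma EH_between:
  "z \<in> X \<Longrightarrow> x \<in> X \<Longrightarrow> b \<le> z \<Longrightarrow> z \<le> x \<Longrightarrow> EH z \<le> max (EH b) (EH x)"
  using quasiconvex_on_between[OF EH_quasiconvex b_in_X] by blast

lemma level_cost_nonneg: "y \<in> X \<Longrightarrow> 0 \<le> level_cost y"
  using EH_nonneg[of y] K_pos cbar_pos mean_D_nonneg by (simp add: level_cost_def le_max_iff_disj)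

lemma level_cost_mono: "z \<in> X \<Longrightarrow> x \<in> X \<Longrightarrow> b \<le> z \<Longrightarrow> z \<le> x \<Longrightarrow> level_cost z \<le> level_cost x"
  using EH_between by (simp add: level_cost_def)

lemma max_b_in_X: "x \<in> X \<Longrightarrow> max b x \<in> X"
  using b_in_X by (simp add: max_def)

lemma base_bound_nonneg: "x \<in> X \<Longrightarrow> \<alpha> < 1 \<Longrightarrow> 0 \<le> base_bound \<alpha> x"
  using K_pos cbar_pos level_cost_nonneg[OF max_b_in_X] by (simp add: base_bound_def)

lemma base_bound_measurable: "(\<lambda>x. ennreal (base_bound \<alpha> x)) \<in> borel_measurable SX"
proof -
  have [measurable]: "(\<lambda>x. x) \<in> borel_measurable SX" "EH \<in> borel_measurable SX"
    by (simp_all add: SX_def measurable_restrict_space1 EH_measurable[unfolded SX_def])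
  have "(\<lambda>x. EH (max b x)) \<in> borel_measurable SX"
  proof (rule measurable_compose[of "max b" _ SX])
    have "max b \<in> SX \<rightarrow>\<^sub>M restrict_space borel X"
      using max_b_in_X by (intro measurable_restrict_space2) auto
    then show "max b \<in> SX \<rightarrow>\<^sub>M SX" by (simp add: SX_def)
  qed measurable
  then show ?thesis unfolding base_bound_def level_cost_def by measurable
qed

lemma base_bound_next:
  assumes "y \<in> X" "\<omega> \<in> space M" "\<alpha> < 1"
  shows "base_bound \<alpha> (y - D 1 \<omega>) \<le>
    K + cbar * max 0 (b - y) + level_cost (max b y) / (1 - \<alpha>) + cbar * D 1 \<omega>"
proof -
  have z: "y - D 1 \<omega> \<in> X" and d: "0 \<le> D 1 \<omega>"
    using assms minus_demand_in_X D_nonneg by auto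
  have "level_cost (max b (y - D 1 \<omega>)) \<le> level_cost (max b y)"
    using assms z d by (intro level_cost_mono max_b_in_X) auto
  then have "level_cost (max b (y - D 1 \<omega>)) / (1 - \<alpha>) \<le> level_cost (max b y) / (1 - \<alpha>)"
    using assms by (simp add: divide_right_mono)
  moreover have "(if y - D 1 \<omega> < b then K + cbar * (b - (y - D 1 \<omega>)) else 0)
      \<le> K + cbar * max 0 (b - y) + cbar * D 1 \<omega>"
  proof -
    have "cbar * (b - (y - D 1 \<omega>)) \<le> cbar * (max 0 (b - y) + D 1 \<omega>)"
      using cbar_pos by (intro mult_left_mono) auto
    moreover have "0 \<le> cbar * max 0 (b - y)" "0 \<le> cbar * D 1 \<omega>" using cbar_pos d by auto
    ultimately show ?thesis using K_pos by (simp add: distrib_left)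
  qed
  ultimately show ?thesis unfolding base_bound_def by simp
qed

lemma mean_next_base_bound:
  assumes y: "y \<in> X" and \<alpha>: "\<alpha> < 1"
  shows "mean_next (\<lambda>x. ennreal (base_bound \<alpha> x)) y \<le>
    ennreal (K + cbar * max 0 (b - y) + level_cost (max b y) / (1 - \<alpha>) + cbar * expectation (D 1))"
proof -
  have "0 \<le> K + cbar * max 0 (b - y) + level_cost (max b y) / (1 - \<alpha>)"
    using K_pos cbar_pos level_cost_nonneg[OF max_b_in_X[OF y]] \<alpha> by simp
  then show ?thesis
    unfolding mean_next_def using base_bound_next[OF y _ \<alpha>] cbar_pos
    by (subst mean_next_affine[symmetric]) (auto intro!: nn_integral_mono ennreal_leI)
qed

definition base_stock :: "real \<Rightarrow> real" where
  "base_stock x = max 0 (b - x)"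

lemma base_stock_measurable: "base_stock \<in> SX \<rightarrow>\<^sub>M SA"
proof -
  have [measurable]: "(\<lambda>x. x) \<in> borel_measurable SX"
    by (simp add: SX_def measurable_restrict_space1)
  have "(0::real) \<in> A" using spaces by auto
  then have "base_stock x \<in> A" if "x \<in> X" for x
    using diff_in_A[OF that b_in_X] by (auto simp: base_stock_def max_def)
  moreover have "base_stock \<in> borel_measurable SX"
    unfolding base_stock_def[abs_def] by measurable
  ultimately show ?thesis unfolding SA_def by (intro measurable_restrict_space2) auto
qed

text \<open>The mean cost of the next reorder is already part of \<open>level_cost\<close>, so with
  \<open>L\<close> for \<open>level_cost y\<close> the inequality reduces to
  \<open>L + \<alpha> * (L / (1 - \<alpha>)) = L / (1 - \<alpha>)\<close>.\<close>

lemma base_stock_supersolution: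
  assumes \<alpha>: "0 \<le> \<alpha>" "\<alpha> < 1" and x: "x \<in> X"
  shows "ennreal (cost x (base_stock x)) +
      ennreal \<alpha> * mean_next (\<lambda>x. ennreal (base_bound \<alpha> x)) (x + base_stock x)
    \<le> ennreal (base_bound \<alpha> x)"
proof -
  let ?U = "\<lambda>x. ennreal (base_bound \<alpha> x)"
  have post: "post \<alpha> ?U y \<le> ennreal (level_cost y / (1 - \<alpha>))" if y: "y \<in> X" "b \<le> y" for y
  proof -
    let ?r = "K + level_cost y / (1 - \<alpha>) + cbar * expectation (D 1)"
    have r: "0 \<le> ?r" using K_pos cbar_pos level_cost_nonneg[OF y(1)] \<alpha> mean_D_nonneg by simp
    have "mean_next ?U y \<le> ennreal ?r"
      using mean_next_base_bound[OF y(1) \<alpha>(2)] y by (simp add: max_def split: if_splits)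
    then have "post \<alpha> ?U y \<le> ennreal (EH y) + ennreal \<alpha> * ennreal ?r"
      unfolding post_def by (intro add_left_mono mult_left_mono) auto
    also have "\<dots> = ennreal (EH y + \<alpha> * ?r)"
      using \<alpha> r EH_nonneg[OF y(1)] by (simp add: ennreal_mult[symmetric])
    also have "EH y + \<alpha> * ?r \<le> level_cost y / (1 - \<alpha>)"
    proof -
      have "\<alpha> * (K + cbar * expectation (D 1)) \<le> K + cbar * expectation (D 1)"
        using \<alpha> K_pos cbar_pos mean_D_nonneg by (intro mult_left_le_one_le) auto
      then have "EH y + \<alpha> * ?r \<le> level_cost y + \<alpha> * (level_cost y / (1 - \<alpha>))"
        by (simp add: level_cost_def distrib_left)
      also have "\<dots> = level_cost y / (1 - \<alpha>)" using \<alpha> by (simp add: field_simps)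
      finally show ?thesis .
    qed
    finally show ?thesis by (simp add: ennreal_leI)
  qed
  show ?thesis
  proof (cases "x < b")
    case True
    then have "ennreal (cost x (base_stock x)) + ennreal \<alpha> * mean_next ?U (x + base_stock x) =
      ennreal (K + cbar * (b - x)) + post \<alpha> ?U b"
      using cost_order[OF x b_in_X] by (simp add: base_stock_def)
    also have "\<dots> \<le> ennreal (K + cbar * (b - x)) + ennreal (level_cost b / (1 - \<alpha>))"
      using post[OF b_in_X] by (intro add_left_mono) simp
    also have "\<dots> = ?U x"
      using True K_pos cbar_pos level_cost_nonneg[OF b_in_X] \<alpha>
      by (simp add: base_bound_def ennreal_plus[symmetric] del: ennreal_plus)
    finally show ?thesis .
  next
    case False
    then have "base_stock x = 0" by (simp add: base_stock_def)
    then show ?thesis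
      using False post[OF x] cost_stay[of x \<alpha> ?U] by (simp add: base_bound_def max_def)
  qed
qed

lemma disc_value_le_base_bound:
  assumes \<alpha>: "0 \<le> \<alpha>" "\<alpha> < 1" and x: "x \<in> X"
  shows "disc_value \<alpha> x \<le> ennreal (base_bound \<alpha> x)"
proof (rule disc_value_le_supersolution[OF x \<alpha> base_bound_measurable])
  fix \<epsilon> :: real
  show "\<exists>f\<in>SX \<rightarrow>\<^sub>M SA. \<forall>y\<in>X. ennreal (cost y (f y)) +
      ennreal \<alpha> * mean_next (\<lambda>x. ennreal (base_bound \<alpha> x)) (y + f y)
    \<le> ennreal (base_bound \<alpha> y) + ennreal \<epsilon>"
    using base_stock_supersolution[OF \<alpha>] base_stock_measurable
    by (intro bexI[of _ base_stock]) (auto intro: add_increasing2)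
qed

text \<open>From \<open>b\<close>, the policy keeps the stock at most \<open>b\<close>, and a period
  costs on average at most \<epsilon> beyond the change of a bounding function. With \<alpha> = 1
  the total over \<open>N\<close> periods is at most \<open>K + \<epsilon> * N\<close>.\<close>

lemma avg_value_base_stock: "avg_value b < \<infinity>"
proof -
  \<comment> \<open>The value \<infinity> makes the inequality trivial above \<open>b\<close>, where
    the policy never goes from \<open>b\<close>. Including \<open>K\<close> at \<open>b\<close>
    itself makes the formula affine in the demand, zero demand included.\<close>
  let ?W = "\<lambda>x. if x \<le> b then ennreal (K + cbar * (b - x)) else \<infinity>"
  define \<epsilon> where "\<epsilon> = EH b + K + cbar * expectation (D 1)"
  have \<epsilon>: "0 \<le> \<epsilon>" using EH_nonneg[OF b_in_X] K_pos cbar_pos mean_D_nonneg by (simp add: \<epsilon>_def)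
  have [measurable]: "(\<lambda>x. x) \<in> borel_measurable SX"
    by (simp add: SX_def measurable_restrict_space1)
  have W: "?W \<in> borel_measurable SX" by measurable
  have mean: "mean_next ?W b \<le> ennreal (K + cbar * expectation (D 1))"
    unfolding mean_next_def using K_pos cbar_pos D_nonneg[of 1]
    by (subst mean_next_affine[symmetric]) (auto intro!: nn_integral_mono)
  have post: "post 1 ?W b \<le> ennreal \<epsilon>"
    using add_left_mono[OF mean, of "ennreal (EH b)"] EH_nonneg[OF b_in_X] K_pos cbar_pos mean_D_nonneg
    unfolding post_def \<epsilon>_def by (simp add: add.assoc)
  have sup: "ennreal (cost y (base_stock y)) + ennreal 1 * mean_next ?W (y + base_stock y) \<le> ?W y + ennreal \<epsilon>"
    if y: "y \<in> X" for y
  proof (cases y b rule: linorder_cases)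
    case less
    then have "ennreal (cost y (base_stock y)) + ennreal 1 * mean_next ?W (y + base_stock y) =
      ennreal (K + cbar * (b - y)) + post 1 ?W b"
      using cost_order[OF y b_in_X, of 1 ?W] by (simp add: base_stock_def)
    then show ?thesis using less post by (simp add: add_left_mono)
  next
    case equal
    then show ?thesis
      using post cost_stay[of b 1 ?W] by (simp add: base_stock_def add_increasing)
  qed simp
  have \<pi>: "markov base_stock \<in> policies" by (rule markov_policy[OF base_stock_measurable])
  have "(\<Sum>t<N. stage_cost (markov base_stock) b t) \<le> ennreal (K + \<epsilon> * real N)" for N
  proof -
    have "(\<Sum>t<N. stage_cost (markov base_stock) b t) \<le>
        (\<Sum>t<N. ennreal (1 ^ t) * stage_cost (markov base_stock) b t) +
        ennreal (1 ^ N) * (\<integral>\<^sup>+\<omega>. ?W (fst (\<omega> N)) \<partial>traj (markov base_stock) b)" by simp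
    also have "\<dots> \<le> ?W b + ennreal \<epsilon> * (\<Sum>t<N. ennreal (1 ^ t))"
      by (rule partial_sum_le_supersolution[OF b_in_X base_stock_measurable _ W sup]) simp
    also have "\<dots> = ennreal K + ennreal \<epsilon> * ennreal (real N)"
      by (simp add: ennreal_of_nat_eq_real_of_nat)
    also have "\<dots> = ennreal (K + \<epsilon> * real N)"
      using K_pos \<epsilon> by (simp add: ennreal_mult)
    finally show ?thesis .
  qed
  then have "ennreal (1 / real N) * (\<Sum>t<N. stage_cost (markov base_stock) b t) \<le> ennreal (K + \<epsilon>)" for N
  proof -
    have "ennreal (1 / real N) * (\<Sum>t<N. stage_cost (markov base_stock) b t) \<le>
      ennreal (1 / real N) * ennreal (K + \<epsilon> * real N)"
      by (intro mult_left_mono) (fact, simp)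
    also have "\<dots> = ennreal (1 / real N * (K + \<epsilon> * real N))"
      using K_pos \<epsilon> by (intro ennreal_mult[symmetric]) auto
    also have "1 / real N * (K + \<epsilon> * real N) \<le> K + \<epsilon>"
    \<comment> \<open>For \<open>N = 0\<close> the factor \<open>1 / real N\<close> is 0 by
      convention.\<close>
    proof (cases N)
      case (Suc n)
      then show ?thesis using K_pos \<epsilon> by (simp add: field_simps)
    qed (use K_pos \<epsilon> in simp)
    finally show ?thesis by (simp add: ennreal_leI)
  qed
  then have "avg_value_pol (markov base_stock) b \<le> ennreal (K + \<epsilon>)"
    unfolding avg_value_pol_eq[OF b_in_X \<pi>] by (intro Limsup_bounded always_eventually allI)
  moreover have "avg_value b \<le> avg_value_pol (markov base_stock) b"
    unfolding avg_value_def by (rule INF_lower[OF \<pi>])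
  ultimately have "avg_value b \<le> ennreal (K + \<epsilon>)" by (rule order_trans[rotated])
  then show ?thesis by (rule le_less_trans) simp
qed

section \<open>The value at \<open>b\<close> compared with the values elsewhere\<close>

lemma base_bound_order:
  assumes "x \<in> X" "z \<in> X" "x \<le> z" "\<alpha> < 1"
  shows "base_bound \<alpha> x \<le> K + cbar * (z - x) + base_bound \<alpha> z"
proof -
  have "level_cost (max b x) \<le> level_cost (max b z)"
    using assms by (intro level_cost_mono max_b_in_X) auto
  then have "level_cost (max b x) / (1 - \<alpha>) \<le> level_cost (max b z) / (1 - \<alpha>)"
    using assms by (simp add: divide_right_mono)
  moreover have "(if x < b then K + cbar * (b - x) else 0) \<le>
      K + cbar * (z - x) + (if z < b then K + cbar * (b - z) else 0)"
  proof -
    have "cbar * (b - x) = cbar * (z - x) + cbar * (b - z)" by (simp add: algebra_simps)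
    moreover have "b \<le> z \<Longrightarrow> cbar * (b - z) \<le> 0" "0 \<le> cbar * (z - x)" "z < b \<Longrightarrow> 0 \<le> cbar * (b - z)"
      using cbar_pos assms by (auto simp: mult_le_0_iff)
    ultimately show ?thesis using K_pos by auto
  qed
  ultimately show ?thesis unfolding base_bound_def by simp
qed

lemma base_bound_mono:
  assumes "x \<in> X" "z \<in> X" "b \<le> x" "x \<le> z" "\<alpha> < 1"
  shows "base_bound \<alpha> x \<le> base_bound \<alpha> z"
proof -
  have "level_cost (max b x) \<le> level_cost (max b z)"
    using assms by (intro level_cost_mono max_b_in_X) auto
  then show ?thesis using assms by (simp add: base_bound_def divide_right_mono)
qed

text \<open>Supplies the growth condition of value iteration. Far below \<open>b\<close>, an action
  either covers the deficit, and is charged for it at rate \<open>cbar\<close>, or leaves a gap to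
  \<open>b\<close>, on which \<open>EH\<close> grows at rate at least
  \<open>(1 - \<alpha>) * cbar\<close> by \<open>dec\<close>. The latter case produces the term
  \<open>c / (1 - \<alpha>)\<close>.\<close>

lemma base_bound_growth:
  assumes \<alpha>: "0 \<le> \<alpha>" "\<alpha> < 1"
    and dec: "\<And>x x'. x \<in> X \<Longrightarrow> x' \<in> X \<Longrightarrow> x \<le> x' \<Longrightarrow> x' \<le> b \<Longrightarrow>
      EH x' + (1 - \<alpha>) * cbar * (x' - x) \<le> EH x"
    and y: "y \<in> X" and a: "a \<in> A"
  defines "c \<equiv> cost y a"
  shows "base_bound \<alpha> y \<le> K + level_cost b / (1 - \<alpha>) + c + c / (1 - \<alpha>)"
proof -
  have ya: "y + a \<in> X" using y a by (rule plus_in_X)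
  have a0: "0 \<le> cbar * a" using A_nonneg[OF a] cbar_pos by simp
  have c: "EH (y + a) \<le> c" "cbar * a \<le> c" "0 \<le> c"
    using a0 EH_nonneg[OF ya] K_pos by (auto simp: c_def cost_eq)
  have c': "0 \<le> c / (1 - \<alpha>)" using c \<alpha> by simp
  show ?thesis
  proof (cases "y < b")
    case False
    have "EH y \<le> max (EH b) (EH (y + a))"
      using False A_nonneg[OF a] by (intro EH_between y ya) auto
    then have "level_cost y \<le> level_cost b + c"
      using c EH_nonneg[OF b_in_X] by (auto simp: level_cost_def max_def split: if_splits)
    then have "level_cost y / (1 - \<alpha>) \<le> level_cost b / (1 - \<alpha>) + c / (1 - \<alpha>)"
      using \<alpha> by (simp add: add_divide_distrib[symmetric] divide_right_mono)
    then show ?thesis using False c K_pos by (simp add: base_bound_def max_def)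
  next
    case True
    have "cbar * (b - y) \<le> c + c / (1 - \<alpha>)"
    proof (cases "b \<le> y + a")
      case True
      then have "cbar * (b - y) \<le> cbar * a" using cbar_pos by simp
      then show ?thesis using c c' by simp
    next
      case False
      then have "(1 - \<alpha>) * (cbar * (b - (y + a))) \<le> c"
        using dec[OF ya b_in_X] c EH_nonneg[OF b_in_X] by (simp add: mult.assoc)
      then have "cbar * (b - (y + a)) \<le> c / (1 - \<alpha>)"
        using \<alpha> by (simp add: pos_le_divide_eq mult.commute)
      then show ?thesis using c by (simp add: algebra_simps)
    qed
    then show ?thesis using True by (simp add: base_bound_def)
  qed
qed

text \<open>The comparisons between states hold for every iterate started at
  \<open>base_bound\<close> and pass to the infimum over the iterates, because the additive
  constants do not depend on \<open>n\<close>. The inequality for staying comes from the fixed-point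
  property of the limit.\<close>

lemma
  assumes \<alpha>: "0 \<le> \<alpha>" "\<alpha> < 1"
    and dec: "\<And>x x'. x \<in> X \<Longrightarrow> x' \<in> X \<Longrightarrow> x \<le> x' \<Longrightarrow> x' \<le> b \<Longrightarrow>
      EH x' + (1 - \<alpha>) * cbar * (x' - x) \<le> EH x"
  shows disc_value_le_order:
      "\<And>x z. x \<in> X \<Longrightarrow> z \<in> X \<Longrightarrow> x \<le> z \<Longrightarrow>
        disc_value \<alpha> x \<le> ennreal (K + cbar * (z - x)) + disc_value \<alpha> z"
    and disc_value_understocked: "\<And>x. x \<in> X \<Longrightarrow> x \<le> b \<Longrightarrow> disc_value \<alpha> b \<le> disc_value \<alpha> x"
    and disc_value_overstocked:
      "\<And>B y. b \<le> B \<Longrightarrow>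
        (\<And>z. z \<in> X \<Longrightarrow> B < z \<Longrightarrow> EH b + cbar * expectation (D 1) + K \<le> EH z) \<Longrightarrow>
        y \<in> X \<Longrightarrow> B < y \<Longrightarrow> disc_value \<alpha> b \<le> disc_value \<alpha> y + ennreal (K + cbar * (B - b))"
    and disc_value_le_stay: "\<And>x. x \<in> X \<Longrightarrow> disc_value \<alpha> x \<le> post \<alpha> (disc_value \<alpha>) x"
proof -
  let ?U = "\<lambda>x. ennreal (base_bound \<alpha> x)"
  define w where "w n = (bellman \<alpha> ^^ n) ?U" for n
  have w0: "w 0 = ?U" and wSuc: "\<And>n. w (Suc n) = bellman \<alpha> (w n)" by (simp_all add: w_def)
  have w: "w n \<in> borel_measurable SX" for n
    by (induction n) (simp_all add: w0 wSuc base_bound_measurable bellman_measurable)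
  have super: "bellman \<alpha> ?U y \<le> ?U y" if "y \<in> X" for y
  proof -
    have "base_stock y \<in> A" using measurable_space[OF base_stock_measurable] that by simp
    then show ?thesis
      using bellman_le_cost[OF that] base_stock_supersolution[OF \<alpha> that] by (blast intro: order_trans)
  qed
  have fin: "mean_next ?U y < \<infinity>" if "y \<in> X" for y
    using mean_next_base_bound[OF that \<alpha>(2)] by (rule le_less_trans) simp
  \<comment> \<open>The summands collect the coefficients of the growth bound, so that expanding
    \<open>C * (1 + cost y a)\<close> dominates it term by term.\<close>
  define C where "C = K + level_cost b / (1 - \<alpha>) + 1 + 1 / (1 - \<alpha>)"
  have growth: "?U y \<le> ennreal C * (1 + ennreal (cost y a))" if y: "y \<in> X" and a: "a \<in> A" for y a
  proof -
    let ?c = "cost y a"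
    have c: "0 \<le> ?c"
      using A_nonneg[OF a] EH_nonneg[OF plus_in_X[OF y a]] cbar_pos K_pos by (simp add: cost_eq)
    have nonneg: "0 \<le> K + level_cost b / (1 - \<alpha>)" "0 \<le> 1 / (1 - \<alpha>)"
      using K_pos level_cost_nonneg[OF b_in_X] \<alpha> by simp_all
    have "base_bound \<alpha> y \<le> K + level_cost b / (1 - \<alpha>) + ?c + ?c / (1 - \<alpha>)"
      by (rule base_bound_growth[OF \<alpha> dec y a])
    also have "\<dots> \<le> C * (1 + ?c)"
    proof -
      have "(p + 1 + q) * (1 + ?c) = p + ?c + q * ?c + (p * ?c + 1 + q)" for p q
        by (simp add: algebra_simps)
      from this[of "K + level_cost b / (1 - \<alpha>)" "1 / (1 - \<alpha>)"]
      have "C * (1 + ?c) = K + level_cost b / (1 - \<alpha>) + ?c + ?c / (1 - \<alpha>) +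
          ((K + level_cost b / (1 - \<alpha>)) * ?c + 1 + 1 / (1 - \<alpha>))"
        by (simp only: C_def times_divide_eq_left mult_1_left)
      moreover have "0 \<le> (K + level_cost b / (1 - \<alpha>)) * ?c" using nonneg(1) c by (rule mult_nonneg_nonneg)
      ultimately show ?thesis using nonneg(2) by linarith
    qed
    finally have "?U y \<le> ennreal (C * (1 + ?c))" by (rule ennreal_leI)
    also have "\<dots> = ennreal C * (1 + ennreal ?c)"
    proof -
      have "0 \<le> C" using nonneg by (simp add: C_def)
      then have "ennreal (C * (1 + ?c)) = ennreal C * ennreal (1 + ?c)" using c by (intro ennreal_mult) auto
      also have "ennreal (1 + ?c) = 1 + ennreal ?c" using c by simp
      finally show ?thesis .
    qed
    finally show ?thesis .
  qed
  have val: "disc_value \<alpha> x = (INF n. w n x)" if "x \<in> X" for x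
    unfolding w_def
    by (rule disc_value_eq_value_iteration[OF \<alpha> base_bound_measurable super fin growth that])
  show "disc_value \<alpha> x \<le> post \<alpha> (disc_value \<alpha>) x" if "x \<in> X" for x
    by (rule disc_value_le_post[OF \<alpha> base_bound_measurable super fin growth that])
  \<comment> \<open>Only iterate 0 needs an argument of its own: any function in the image of
    \<open>bellman\<close> has this property, so no induction occurs.\<close>
  have order: "w n x \<le> ennreal (K + cbar * (z - x)) + w n z"
    if "x \<in> X" "z \<in> X" "x \<le> z" for n x z
  proof (cases n)
    case 0
    have "0 \<le> K + cbar * (z - x)" using that K_pos cbar_pos by simp
    then have "ennreal (K + cbar * (z - x)) + w n z = ennreal (K + cbar * (z - x) + base_bound \<alpha> z)"
      using base_bound_nonneg[OF that(2) \<alpha>(2)] by (simp only: 0 w0 ennreal_plus)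
    then show ?thesis
      using base_bound_order[OF that \<alpha>(2)] by (simp only: 0 w0 ennreal_leI)
  next
    case (Suc m)
    then show ?thesis using that by (simp only: wSuc bellman_le_order_up)
  qed
  show "disc_value \<alpha> x \<le> ennreal (K + cbar * (z - x)) + disc_value \<alpha> z"
    if x: "x \<in> X" "z \<in> X" "x \<le> z" for x z
    unfolding val[OF x(1)] val[OF x(2)] INF_ennreal_const_add[symmetric]
    by (intro INF_mono) (use order[OF x] in blast)
  have anti: "w n x' + ennreal (cbar * (x' - x)) \<le> w n x"
    if "x \<in> X" "x' \<in> X" "x \<le> x'" "x' \<le> b" for n x x'
    using that
  proof (induction n arbitrary: x x')
    \<comment> \<open>Below \<open>b\<close> the bound has slope exactly \<open>- cbar\<close>, its
      \<open>level_cost\<close> part being constant there; the drop by \<open>K\<close> at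
      \<open>b\<close> works in the right direction.\<close>
    case 0
    have "0 \<le> cbar * (x' - x)" using 0 cbar_pos by simp
    then have "w 0 x' + ennreal (cbar * (x' - x)) = ennreal (base_bound \<alpha> x' + cbar * (x' - x))"
      using base_bound_nonneg[OF 0(2) \<alpha>(2)] by (simp only: w0 ennreal_plus)
    also have "\<dots> \<le> w 0 x"
      using 0 K_pos unfolding w0
      by (intro ennreal_leI) (auto simp: base_bound_def max_def algebra_simps)
    finally show ?case .
  next
    case (Suc n)
    show ?case
      unfolding wSuc using \<alpha> Suc.prems
      by (intro bellman_antimono_transformed[where b=b] w dec Suc.IH) auto
  qed
  show "disc_value \<alpha> b \<le> disc_value \<alpha> x" if x: "x \<in> X" "x \<le> b" for x
  proof -
    have "w n b \<le> w n x" for n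
      using anti[OF x(1) b_in_X x(2) order_refl, of n] by (rule order_trans[rotated]) simp
    then show ?thesis unfolding val[OF x(1)] val[OF b_in_X] by (intro INF_mono) blast
  qed
  fix B y
  assume B: "b \<le> B" "\<And>z. z \<in> X \<Longrightarrow> B < z \<Longrightarrow> EH b + cbar * expectation (D 1) + K \<le> EH z"
    and y: "y \<in> X" "B < y"
  have "w n b \<le> w n z + ennreal (K + cbar * (B - b))" if "z \<in> X" "B < z" for n z
    using that
  proof (induction n arbitrary: z)
    case 0
    have "base_bound \<alpha> b \<le> base_bound \<alpha> z"
      using 0 B(1) \<alpha> b_in_X by (intro base_bound_mono) auto
    then show ?case by (simp add: w0 add_increasing2 ennreal_leI)
  next
    case (Suc n)
    show ?case
      unfolding wSuc using \<alpha> Suc.prems B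
      by (intro bellman_overstocked w b_in_X order Suc.IH) auto
  qed
  then show "disc_value \<alpha> b \<le> disc_value \<alpha> y + ennreal (K + cbar * (B - b))"
    unfolding val[OF y(1)] val[OF b_in_X] INF_ennreal_add_const[symmetric]
    by (intro INF_mono) (use y in blast)
qed

text \<open>For states between \<open>b\<close> and \<open>B\<close> neither monotonicity nor
  excessive holding cost is available. There one orders from \<open>b\<close> to the state in
  question, at a cost within the constant obtained for overstocked states.\<close>

lemma disc_value_b_le:
  assumes \<alpha>: "0 \<le> \<alpha>" "\<alpha> < 1"
    and dec: "\<And>x x'. x \<in> X \<Longrightarrow> x' \<in> X \<Longrightarrow> x \<le> x' \<Longrightarrow> x' \<le> b \<Longrightarrow>
      EH x' + (1 - \<alpha>) * cbar * (x' - x) \<le> EH x"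
    and B: "b \<le> B" "\<And>y. y \<in> X \<Longrightarrow> B < y \<Longrightarrow> EH b + cbar * expectation (D 1) + K \<le> EH y"
  shows "disc_value \<alpha> b \<le> min_disc_value \<alpha> + ennreal (K + cbar * (B - b))"
proof -
  let ?C = "ennreal (K + cbar * (B - b))"
  have "disc_value \<alpha> b \<le> disc_value \<alpha> y + ?C" if y: "y \<in> X" for y
  proof -
    consider "y \<le> b" | "b \<le> y" "y \<le> B" | "B < y" by linarith
    then show ?thesis
    proof cases
      case 1
      then show ?thesis using disc_value_understocked[OF \<alpha> dec y] by (simp add: add_increasing2)
    next
      case 2
      have "disc_value \<alpha> b \<le> ennreal (K + cbar * (y - b)) + disc_value \<alpha> y"
        by (rule disc_value_le_order[OF \<alpha> dec b_in_X y 2(1)])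
      also have "\<dots> \<le> ?C + disc_value \<alpha> y"
        using 2 cbar_pos by (intro add_right_mono ennreal_leI) simp
      finally show ?thesis by (simp only: add.commute)
    next
      case 3
      then show ?thesis using disc_value_overstocked[OF \<alpha> dec B y] by blast
    qed
  qed
  then have "disc_value \<alpha> b - ?C \<le> min_disc_value \<alpha>"
    unfolding min_disc_value_def
    by (intro INF_greatest) (simp add: ennreal_minus_le_iff add.commute)
  then show ?thesis by (simp add: ennreal_minus_le_iff add.commute)
qed

section \<open>Descent to \<open>b\<close> from an arbitrary state\<close>

text \<open>Truncation at 1 bounds the credit that a single demand can consume, and the mean stays
  positive since the truncated demand is positive exactly when the demand is.\<close>

lemma expectation_min_demand_pos: "0 < expectation (\<lambda>\<omega>. min (D 1 \<omega>) 1)"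
proof -
  have [measurable]: "D 1 \<in> borel_measurable M" by (rule D_measurable) simp
  have int: "integrable M (\<lambda>\<omega>. min (D 1 \<omega>) 1)"
    using D_integrable by (intro integrable_min) auto
  have nonneg: "AE \<omega> in M. 0 \<le> min (D 1 \<omega>) 1" using D_nonneg[of 1] by (intro AE_I2) auto
  have ev: "{\<omega> \<in> space M. 0 < D 1 \<omega>} \<in> events" by measurable
  have "expectation (\<lambda>\<omega>. min (D 1 \<omega>) 1) \<noteq> 0"
  proof
    assume "expectation (\<lambda>\<omega>. min (D 1 \<omega>) 1) = 0"
    then have "AE \<omega> in M. min (D 1 \<omega>) 1 = 0"
      using integral_nonneg_eq_0_iff_AE[OF int nonneg] by blast
    then have "AE \<omega> in M. \<not> 0 < D 1 \<omega>" by eventually_elim (auto simp: min_def split: if_splits)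
    then have "prob {\<omega> \<in> space M. 0 < D 1 \<omega>} = 0"
      using prob_Collect_eq_0[OF ev] by blast
    then show False using D_nontrivial by simp
  qed
  moreover have "0 \<le> expectation (\<lambda>\<omega>. min (D 1 \<omega>) 1)"
    using nonneg by (rule integral_nonneg_AE)
  ultimately show ?thesis by simp
qed

text \<open>A bound for the cost of placing no orders from level \<open>x\<close> until the inventory falls below
  \<open>b\<close>, and then ordering up to \<open>b\<close>, when holding costs before are at most \<open>c\<close>. The slope is chosen
  such that the drift of the inventory, truncated at \<open>1\<close>, pays for one period.\<close>

definition descent_bound :: "real \<Rightarrow> real \<Rightarrow> real" where
  "descent_bound c x =
     (let s = (c + cbar * expectation (D 1)) / expectation (\<lambda>\<omega>. min (D 1 \<omega>) 1)
      in if x < b then K + cbar * (b - x) else K + s + s * (x - b))"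

lemma descent_bound_nonneg:
  assumes "0 \<le> c"
  shows "0 \<le> descent_bound c x"
proof -
  define s where "s = (c + cbar * expectation (D 1)) / expectation (\<lambda>\<omega>. min (D 1 \<omega>) 1)"
  have "0 \<le> s"
    unfolding s_def using assms cbar_pos mean_D_nonneg expectation_min_demand_pos by simp
  then have "0 \<le> (if x < b then K + cbar * (b - x) else K + s + s * (x - b))"
    using K_pos cbar_pos by simp
  then show ?thesis by (simp only: descent_bound_def Let_def s_def)
qed

text \<open>A Lyapunov drift inequality: the bound decreases in mean by at least the holding charge
  \<open>c\<close> while the stock is at or above \<open>b\<close>.\<close>

lemma mean_next_descent_bound:
  assumes c: "0 \<le> c" and x: "b \<le> x"
  shows "ennreal c + mean_next (\<lambda>z. ennreal (descent_bound c z)) x \<le> ennreal (descent_bound c x)"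
proof -
  define e where "e = expectation (\<lambda>\<omega>. min (D 1 \<omega>) 1)"
  define s where "s = (c + cbar * expectation (D 1)) / e"
  have e: "0 < e" unfolding e_def by (rule expectation_min_demand_pos)
  have s: "0 \<le> s" "s * e = c + cbar * expectation (D 1)"
    using c e cbar_pos mean_D_nonneg by (simp_all add: s_def)
  have f: "descent_bound c z = (if z < b then K + cbar * (b - z) else K + s + s * (z - b))" for z
    by (simp add: descent_bound_def Let_def s_def e_def)
  \<comment> \<open>The jump of height \<open>s\<close> at \<open>b\<close> pays for
    \<open>s * min (D 1 \<omega>) 1\<close> when the stock falls below \<open>b\<close>; the
    shortfall is then at most the demand, whence the last term. By the choice of \<open>s\<close>
    the mean of \<open>?g\<close> is the bound at \<open>x\<close> minus \<open>c\<close>.\<close>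
  let ?g = "\<lambda>\<omega>. descent_bound c x - s * min (D 1 \<omega>) 1 + cbar * D 1 \<omega>"
  have [measurable]: "D 1 \<in> borel_measurable M" by (rule D_measurable) simp
  have int_min: "integrable M (\<lambda>\<omega>. min (D 1 \<omega>) 1)"
    using D_integrable by (intro integrable_min) auto
  have le: "descent_bound c (x - D 1 \<omega>) \<le> ?g \<omega>" if \<omega>: "\<omega> \<in> space M" for \<omega>
  proof (cases "x - D 1 \<omega> < b")
    case True
    have "s * min (D 1 \<omega>) 1 \<le> s * 1" using s by (intro mult_left_mono) auto
    moreover have "0 \<le> s * (x - b)" using s x by simp
    moreover have "cbar * (b - (x - D 1 \<omega>)) \<le> cbar * D 1 \<omega>" using x cbar_pos by simp
    moreover have "descent_bound c (x - D 1 \<omega>) = K + cbar * (b - (x - D 1 \<omega>))"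
      using True by (simp only: f if_True)
    moreover have "descent_bound c x = K + s + s * (x - b)" using x by (simp add: f)
    ultimately show ?thesis by linarith
  next
    case False
    have "s * min (D 1 \<omega>) 1 \<le> s * D 1 \<omega>" using s by (intro mult_left_mono) auto
    moreover have "0 \<le> cbar * D 1 \<omega>" using cbar_pos D_nonneg[OF _ \<omega>, of 1] by simp
    ultimately show ?thesis using False x by (simp add: f algebra_simps)
  qed
  have "mean_next (\<lambda>z. ennreal (descent_bound c z)) x \<le> (\<integral>\<^sup>+\<omega>. ennreal (?g \<omega>) \<partial>M)"
    unfolding mean_next_def using le by (intro nn_integral_mono ennreal_leI)
  also have "\<dots> = ennreal (expectation ?g)"
  proof (rule nn_integral_eq_integral)
    show "integrable M ?g" using int_min D_integrable by simp
    show "AE \<omega> in M. 0 \<le> ?g \<omega>"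
      using le descent_bound_nonneg[OF c] by (intro AE_I2) (blast intro: order_trans)
  qed
  also have "expectation ?g = descent_bound c x - c"
    using int_min D_integrable s(2) by (simp add: prob_space e_def)
  finally have m: "mean_next (\<lambda>z. ennreal (descent_bound c z)) x \<le> ennreal (descent_bound c x - c)" .
  \<comment> \<open>Ensures that \<open>ennreal\<close> does not truncate the difference. It holds
    because the truncated mean \<open>e\<close> is at most 1, so \<open>s\<close> is at least
    \<open>s * e\<close>, which is at least \<open>c\<close>.\<close>
  have "c \<le> descent_bound c x"
  proof -
    have "e \<le> 1"
      unfolding e_def using int_min by (intro integral_le_const) auto
    then have "c \<le> s" using s c e cbar_pos mean_D_nonneg mult_left_mono[of e 1 s]
      by (simp add: add_increasing2) (smt (verit) mult_nonneg_nonneg)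
    moreover have "0 \<le> s * (x - b)" using s x by simp
    ultimately show ?thesis using x K_pos by (simp add: f)
  qed
  then have "ennreal c + ennreal (descent_bound c x - c) = ennreal (descent_bound c x)"
    using c by (subst ennreal_plus[symmetric]) auto
  then show ?thesis using add_left_mono[OF m, of "ennreal c"] by simp
qed

text \<open>The inequality for staying is unrolled \<open>n\<close> times, for all states up to
  \<open>x\<close> since the stock can only fall without orders. Quasiconvexity bounds the holding
  costs met above \<open>b\<close> by those at \<open>b\<close> and \<open>x\<close>, so the
  resulting bound is free of \<alpha>; only the vanishing error
  \<open>\<alpha> ^ n * base_bound \<alpha> x\<close> depends on it.\<close>

lemma disc_value_le_b:
  assumes \<alpha>: "0 \<le> \<alpha>" "\<alpha> < 1"
    and dec: "\<And>x x'. x \<in> X \<Longrightarrow> x' \<in> X \<Longrightarrow> x \<le> x' \<Longrightarrow> x' \<le> b \<Longrightarrow>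
      EH x' + (1 - \<alpha>) * cbar * (x' - x) \<le> EH x"
    and x: "x \<in> X"
  shows "disc_value \<alpha> x \<le> disc_value \<alpha> b + ennreal (descent_bound (max (EH b) (EH x)) x)"
proof -
  define c where "c = max (EH b) (EH x)"
  have c: "0 \<le> c" using EH_nonneg[OF b_in_X] by (simp add: c_def le_max_iff_disj)
  let ?f = "\<lambda>z. ennreal (descent_bound c z)" and ?U = "ennreal (base_bound \<alpha> x)"
  have below: "disc_value \<alpha> z \<le> disc_value \<alpha> b + ?f z" if "z \<in> X" "z < b" for z
    using disc_value_le_order[OF \<alpha> dec that(1) b_in_X] that
    by (simp add: descent_bound_def add.commute)
  have f_meas: "?f \<in> borel_measurable SX"
  proof -
    have [measurable]: "(\<lambda>x. x) \<in> borel_measurable SX"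
      by (simp add: SX_def measurable_restrict_space1)
    show ?thesis unfolding descent_bound_def Let_def by measurable
  qed
  have step: "disc_value \<alpha> z \<le> disc_value \<alpha> b + ?f z + ennreal (\<alpha> ^ n) * ?U"
    if "z \<in> X" "z \<le> x" for n z
    using that
  proof (induction n arbitrary: z)
    case (0 z)
    show ?case
    proof (cases "z < b")
      case True
      then show ?thesis using below[OF 0(1)] by (simp add: add_increasing2)
    next
      case False
      have "disc_value \<alpha> z \<le> ennreal (base_bound \<alpha> z)"
        by (rule disc_value_le_base_bound[OF \<alpha> 0(1)])
      also have "\<dots> \<le> ?U"
        using 0 False x \<alpha> by (intro ennreal_leI base_bound_mono) auto
      finally show ?thesis by (simp add: add_increasing)
    qed
  next
    case (Suc n z)
    show ?case
    proof (cases "z < b")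
      case True
      then show ?thesis using below[OF Suc.prems(1)] by (simp add: add_increasing2)
    next
      case False
      let ?r = "disc_value \<alpha> b + ennreal (\<alpha> ^ n) * ?U"
      have "mean_next (disc_value \<alpha>) z \<le> (\<integral>\<^sup>+\<omega>. ?f (z - D 1 \<omega>) + ?r \<partial>M)"
        unfolding mean_next_def
      proof (rule nn_integral_mono)
        fix \<omega> assume \<omega>: "\<omega> \<in> space M"
        have "disc_value \<alpha> (z - D 1 \<omega>) \<le> disc_value \<alpha> b + ?f (z - D 1 \<omega>) + ennreal (\<alpha> ^ n) * ?U"
          using Suc.prems \<omega> D_nonneg[OF _ \<omega>, of 1] by (intro Suc.IH minus_demand_in_X) auto
        then show "disc_value \<alpha> (z - D 1 \<omega>) \<le> ?f (z - D 1 \<omega>) + ?r" by (simp add: ac_simps)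
      qed
      also have "\<dots> = mean_next ?f z + ?r"
        by (rule mean_next_add_const[OF f_meas Suc.prems(1)])
      finally have m: "mean_next (disc_value \<alpha>) z \<le> mean_next ?f z + ?r" .
      have EHz: "EH z \<le> c"
        unfolding c_def using False Suc.prems x by (intro EH_between) auto
      \<comment> \<open>Discounting is discarded in the descent terms and in the value at
        \<open>b\<close>, but kept in the error, which must tend to 0.\<close>
      have le1: "ennreal \<alpha> * u \<le> u" for u
        using mult_right_mono[of "ennreal \<alpha>" 1 u] \<alpha> by simp
      have "disc_value \<alpha> z \<le> ennreal (EH z) + ennreal \<alpha> * mean_next (disc_value \<alpha>) z"
        using disc_value_le_stay[OF \<alpha> dec Suc.prems(1)] by (simp add: post_def)
      also have "\<dots> \<le> ennreal c + ennreal \<alpha> * (mean_next ?f z + ?r)"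
        using EHz m by (intro add_mono mult_left_mono ennreal_leI) auto
      also have "\<dots> = ennreal c + (ennreal \<alpha> * mean_next ?f z + ennreal \<alpha> * disc_value \<alpha> b +
          ennreal (\<alpha> ^ Suc n) * ?U)"
        using \<alpha> by (simp add: distrib_left ennreal_mult ac_simps)
      also have "\<dots> \<le> ennreal c + (mean_next ?f z + disc_value \<alpha> b + ennreal (\<alpha> ^ Suc n) * ?U)"
        by (intro add_mono le1 order_refl)
      also have "\<dots> = (ennreal c + mean_next ?f z) + (disc_value \<alpha> b + ennreal (\<alpha> ^ Suc n) * ?U)"
        by (simp only: ac_simps)
      also have "\<dots> \<le> ?f z + (disc_value \<alpha> b + ennreal (\<alpha> ^ Suc n) * ?U)"
        using mean_next_descent_bound[OF c, of z] False by (intro add_right_mono) auto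
      finally show ?thesis by (simp only: ac_simps)
    qed
  qed
  have "(\<lambda>n. ennreal (\<alpha> ^ n)) \<longlonglongrightarrow> ennreal 0"
    using \<alpha> by (intro tendsto_ennrealI LIMSEQ_realpow_zero)
  then have "(\<lambda>n. ?U * ennreal (\<alpha> ^ n)) \<longlonglongrightarrow> ?U * ennreal 0"
    by (rule ennreal_tendsto_cmult[rotated]) simp
  then have "(\<lambda>n. ennreal (\<alpha> ^ n) * ?U) \<longlonglongrightarrow> ennreal 0 * ?U"
    by (simp only: mult.commute)
  then have "(\<lambda>n. disc_value \<alpha> b + ?f x + ennreal (\<alpha> ^ n) * ?U) \<longlonglongrightarrow> disc_value \<alpha> b + ?f x + ennreal 0 * ?U"
    by (intro tendsto_add tendsto_const)
  then show ?thesis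
    using step[OF x order_refl] by (auto intro: LIMSEQ_le_const simp: c_def)
qed

end

section \<open>Bounds uniform in the discount factor\<close>

theorem theorem4p1:
  fixes M :: "'w measure"
    and D :: "nat \<Rightarrow> 'w \<Rightarrow> real"
    and X A :: "real set"
    and K cbar :: real
    and h :: "real \<Rightarrow> real"
    and alpha_star :: real
  assumes model: "inventory_model M D X A K cbar h"
    and alpha_star: "0 \<le> alpha_star" "alpha_star < 1"
    and quasiconvex: "\<And>\<alpha>. alpha_star < \<alpha> \<Longrightarrow> \<alpha> \<le> 1 \<Longrightarrow>
      quasiconvex_on X (inventory_model.Eh_disc M D cbar h \<alpha>)"
    and limit: "\<And>\<alpha>. alpha_star < \<alpha> \<Longrightarrow> \<alpha> \<le> 1 \<Longrightarrow>
      \<exists>L::ereal. ((\<lambda>x. ereal (inventory_model.Eh_disc M D cbar h \<alpha> x)) \<longlongrightarrow> L)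
          (at_bot \<sqinter> principal X) \<and>
        L > ereal K + (INF x\<in>X. ereal (inventory_model.Eh_disc M D cbar h \<alpha> x))"
  shows "(INF x\<in>X. inventory_model.avg_value M D X A K cbar h x) < \<infinity> \<and>
    (\<forall>x\<in>X. (SUP \<alpha>\<in>{0..<1}. inventory_model.rel_value M D X A K cbar h \<alpha> x) < \<infinity>)"
proof -
  interpret inventory_model M D X A K cbar h by (rule model)
  \<comment> \<open>One factor strictly between \<open>alpha_star\<close> and 1 fixes
    \<open>b\<close> and separates the two ranges of \<alpha>.\<close>
  define \<beta> where "\<beta> = (alpha_star + 1) / 2"
  have \<beta>: "alpha_star < \<beta>" "0 \<le> \<beta>" "\<beta> < 1" using alpha_star by (auto simp: \<beta>_def)
  obtain L where L: "((\<lambda>x. ereal (Eh_disc \<beta> x)) \<longlongrightarrow> L) (at_bot \<sqinter> principal X)"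
    "L > ereal K + (INF x\<in>X. ereal (Eh_disc \<beta> x))"
    using limit[of \<beta>] \<beta> by auto
  obtain b where b: "b \<in> X"
    "\<And>x y. x \<in> X \<Longrightarrow> y \<in> X \<Longrightarrow> x \<le> y \<Longrightarrow> y \<le> b \<Longrightarrow> Eh_disc \<beta> y \<le> Eh_disc \<beta> x"
    using exists_decreasing_level[OF quasiconvex L] \<beta> by auto
  \<comment> \<open>At \<alpha> = 1 the linear term of \<open>Eh_disc\<close> vanishes, and adding a
    constant does not affect quasiconvexity.\<close>
  have "quasiconvex_on X EH"
    using quasiconvex[of 1] alpha_star unfolding quasiconvex_on_def
    by (simp add: Eh_disc_eq max_add_distrib_left[symmetric])
  then interpret base: base_stock_inventory M D X A K cbar h b
    by unfold_locales (use b in auto)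
  obtain B where B: "b \<le> B" "\<And>y. y \<in> X \<Longrightarrow> B < y \<Longrightarrow> EH b + cbar * expectation (D 1) + K \<le> EH y"
    using exists_costly_level[of b "EH b + cbar * expectation (D 1) + K"] by blast
  have dec: "EH y + (1 - \<alpha>) * cbar * (y - x) \<le> EH x"
    if "\<beta> \<le> \<alpha>" "\<alpha> < 1" "x \<in> X" "y \<in> X" "x \<le> y" "y \<le> b" for \<alpha> x y
  proof -
    have "EH y + (1 - \<beta>) * cbar * (y - x) \<le> EH x"
      using b(2)[OF that(3-6)] that by (simp add: Eh_disc_eq algebra_simps)
    moreover have "(1 - \<alpha>) * (cbar * (y - x)) \<le> (1 - \<beta>) * (cbar * (y - x))"
      using that cbar_pos by (intro mult_right_mono) auto
    ultimately show ?thesis by (simp add: mult.assoc)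
  qed
  have "(SUP \<alpha>\<in>{0..<1}. rel_value \<alpha> x) < \<infinity>" if x: "x \<in> X" for x
  proof -
    define C1 where "C1 = ennreal (base.base_bound \<beta> x)"
    define C2 where "C2 = ennreal (K + cbar * (B - b)) +
      ennreal (base.descent_bound (max (EH b) (EH x)) x)"
    have "rel_value \<alpha> x \<le> max C1 C2" if \<alpha>: "\<alpha> \<in> {0..<1}" for \<alpha>
    proof (cases "\<alpha> < \<beta>")
      case True
      have "rel_value \<alpha> x \<le> disc_value \<alpha> x" unfolding rel_value_def by (rule diff_le_self_ennreal)
      also have "\<dots> \<le> ennreal (base.base_bound \<alpha> x)"
        using \<alpha> x by (intro base.disc_value_le_base_bound) auto
      \<comment> \<open>The denominator \<open>1 - \<alpha>\<close> is bounded away from 0 by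
        \<open>1 - \<beta>\<close>.\<close>
      also have "\<dots> \<le> C1"
        unfolding C1_def base.base_bound_def
        using True \<beta> base.level_cost_nonneg[OF base.max_b_in_X[OF x]]
        by (intro ennreal_leI add_left_mono divide_left_mono) auto
      finally show ?thesis by (simp add: le_max_iff_disj)
    next
      case False
      then have \<alpha>': "\<beta> \<le> \<alpha>" "0 \<le> \<alpha>" "\<alpha> < 1" using \<alpha> by auto
      have "disc_value \<alpha> x \<le> disc_value \<alpha> b + ennreal (base.descent_bound (max (EH b) (EH x)) x)"
        using \<alpha>' x by (intro base.disc_value_le_b dec) auto
      also have "\<dots> \<le> min_disc_value \<alpha> + ennreal (K + cbar * (B - b)) +
          ennreal (base.descent_bound (max (EH b) (EH x)) x)"
        using \<alpha>' B by (intro add_right_mono base.disc_value_b_le dec) auto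
      also have "\<dots> = min_disc_value \<alpha> + C2" by (simp only: C2_def add.assoc)
      finally have le: "disc_value \<alpha> x \<le> min_disc_value \<alpha> + C2" .
      \<comment> \<open>Finiteness excludes the case \<infinity> - \<infinity> = \<infinity> in
        \<open>ennreal\<close>, in which the bound on the difference would not follow.\<close>
      have "disc_value \<alpha> x < top"
        using base.disc_value_le_base_bound[OF \<alpha>'(2,3) x] by (rule le_less_trans) simp
      with le have "rel_value \<alpha> x \<le> C2"
        unfolding rel_value_def by (auto simp: ennreal_minus_le_iff)
      then show ?thesis by (simp add: le_max_iff_disj)
    qed
    then have "(SUP \<alpha>\<in>{0..<1}. rel_value \<alpha> x) \<le> max C1 C2" by (rule SUP_least)
    also have "\<dots> < \<infinity>" by (simp add: C1_def C2_def)
    finally show ?thesis .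
  qed
  moreover have "(INF x\<in>X. avg_value x) < \<infinity>"
    using INF_lower[OF b(1), of avg_value] base.avg_value_base_stock by (rule le_less_trans)
  ultimately show ?thesis by blast
qed

end
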